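(* Let $W_i=(Y_i(1),Y_i(0),R_i(1),R_i(0),X_i)$, $1\le i\le n$, be i.i.d. with $Y_i(d)$ real-valued, $R_i(d)\in\{0,1\}$, $E[|Y_i(d)|]<\infty$ and $E[R_i(d)]>0$ for $d\in\{0,1\}$. Let $S:\mathrm{supp}(X_i)\to\mathcal S$ be a function into a finite set $\mathcal S$, $S_i=S(X_i)$, and let $\nu\in(0,1)$. Let $D^{(n)}=(D_1,\dots,D_n)\in\{0,1\}^n$ be a treatment assignment such that (1) $W^{(n)}\perp\!\!\!\perp D^{(n)}\mid S^{(n)}$; (2) $\frac{1}{n}\sum_{1\le i\le n}(D_i-\nu)I\{S_i=s\}\stackrel{P}{\to}0$ for every $s\in\mathcal S$. Let $R_i=R_i(1)D_i+R_i(0)(1-D_i)$ and $Y_i=Y_i(1)R_i(1)D_i+Y_i(0)R_i(0)(1-D_i)$. Let \[\hat\theta_n=\frac{\sum_{1\le i\le n}Y_iR_iD_i}{\sum_{1\le i\le n}R_iD_i}-\frac{\sum_{1\le i\le n}Y_iR_i(1-D_i)}{\sum_{1\le i\le n}R_i(1-D_i)},\] and let $\hat\theta_n^{\rm sfe}$ be the estimator of the coefficient on $D_i$ in the ordinary least squares regression, using only the observations with $R_i=1$, of $Y_i$ on $D_i$ and the strata indicators $I\{S_i=s\}$, $s\in\mathcal S$. Then, as $n\to\infty$, $\hat\theta_n\stackrel{P}{\to}\theta^{\rm obs}$, where \[\theta^{\rm obs}=\frac{E[R_i(1)Y_i(1)]}{E[R_i(1)]}-\frac{E[R_i(0)Y_i(0)]}{E[R_i(0)]}=E[Y_i(1)\mid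 R_i(1)=1]-E[Y_i(0)\mid R_i(0)=1],\] and $\hat\theta_n^{\rm sfe}\stackrel{P}{\to}\theta^{\rm sfe}$, where \[\theta^{\rm sfe}=\left(E\left[\frac{E[R_i(1)\mid S_i]E[R_i(0)\mid S_i]}{\nu E[R_i(1)\mid S_i]+(1-\nu)E[R_i(0)\mid S_i]}\right]\right)^{-1}E\left[\frac{E[R_i(1)Y_i(1)\mid S_i]E[R_i(0)\mid S_i]-E[R_i(0)Y_i(0)\mid S_i]E[R_i(1)\mid S_i]}{\nu E[R_i(1)\mid S_i]+(1-\nu)E[R_i(0)\mid S_i]}\right].\]
   Context: Setting: a stratified experiment with attrition. $Y_i(d)$ is the potential outcome and $R_i(d)$ the potential response indicator ($1$ = not attrited) of unit $i$ under treatment $d\in\{0,1\}$; $X_i$ are observed baseline covariates; $D_i$ is the treatment status; $S_i$ is the stratum label; $\nu$ is the target treated proportion in each stratum. $R_i$ is the realized response indicator and $Y_i$ the observed outcome (set to zero for attrited units). For any variable indexed by $i$, e.g. $D_i$, $D^{(n)}$ denotes $(D_1,\dots,D_n)$. $\perp\!\!\!\perp$ denotes (conditional) independence; $I\{\cdot\}$ is the indicator function; $\stackrel{P}{\to}$ is convergence in probability. *)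

theory Defs
  imports "HOL-Probability.Probability"
begin

definition tendsto_in_prob :: "'w measure \<Rightarrow> (nat \<Rightarrow> 'w \<Rightarrow> real) \<Rightarrow> real \<Rightarrow> bool" where
  "tendsto_in_prob M Z c \<longleftrightarrow>
     (\<forall>n. Z n \<in> borel_measurable M) \<and>
     (\<forall>\<epsilon>>0. (\<lambda>n. measure M {\<omega> \<in> space M. \<bar>Z n \<omega> - c\<bar> > \<epsilon>}) \<longlonglongrightarrow> 0)"

definition sigma_gen :: "'w measure \<Rightarrow> 'c measure \<Rightarrow> ('w \<Rightarrow> 'c) \<Rightarrow> 'w measure" where
  "sigma_gen M C Z = vimage_algebra (space M) Z C"

definition cond_expect ::
  "'w measure \<Rightarrow> 'c measure \<Rightarrow> ('w \<Rightarrow> 'c) \<Rightarrow> ('w \<Rightarrow> real) \<Rightarrow> 'w \<Rightarrow> real" where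
  "cond_expect M C Z f = real_cond_exp M (sigma_gen M C Z) f"

definition cond_expect_event :: "'w measure \<Rightarrow> ('w \<Rightarrow> real) \<Rightarrow> 'w set \<Rightarrow> real" where
  "cond_expect_event M f E = (\<integral>\<omega>. f \<omega> \<partial>(uniform_measure M E))"

definition cond_indep_var ::
  "'w measure \<Rightarrow> 'a measure \<Rightarrow> ('w \<Rightarrow> 'a) \<Rightarrow> 'b measure \<Rightarrow> ('w \<Rightarrow> 'b) \<Rightarrow>
   'c measure \<Rightarrow> ('w \<Rightarrow> 'c) \<Rightarrow> bool" where
  "cond_indep_var M A U B V C Z \<longleftrightarrow>
     U \<in> measurable M A \<and> V \<in> measurable M B \<and> Z \<in> measurable M C \<and>
     (\<forall>a\<in>sets A. \<forall>b\<in>sets B. AE \<omega> in M.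
        cond_expect M C Z (\<lambda>\<omega>'. indicator a (U \<omega>') * indicator b (V \<omega>')) \<omega> =
        cond_expect M C Z (\<lambda>\<omega>'. indicator a (U \<omega>')) \<omega> *
        cond_expect M C Z (\<lambda>\<omega>'. indicator b (V \<omega>')) \<omega>)"

definition realized_response ::
  "(nat \<Rightarrow> 'w \<Rightarrow> real) \<Rightarrow> (nat \<Rightarrow> 'w \<Rightarrow> real) \<Rightarrow> (nat \<Rightarrow> 'w \<Rightarrow> real) \<Rightarrow> nat \<Rightarrow> 'w \<Rightarrow> real" where
  "realized_response R1 R0 D i \<omega> = R1 i \<omega> * D i \<omega> + R0 i \<omega> * (1 - D i \<omega>)"

definition observed_outcome ::
  "(nat \<Rightarrow> 'w \<Rightarrow> real) \<Rightarrow> (nat \<Rightarrow> 'w \<Rightarrow> real) \<Rightarrow> (nat \<Rightarrow> 'w \<Rightarrow> real) \<Rightarrow> (nat \<Rightarrow> 'w \<Rightarrow> real) \<Rightarrow>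
   (nat \<Rightarrow> 'w \<Rightarrow> real) \<Rightarrow> nat \<Rightarrow> 'w \<Rightarrow> real" where
  "observed_outcome Y1 Y0 R1 R0 D i \<omega> =
     Y1 i \<omega> * R1 i \<omega> * D i \<omega> + Y0 i \<omega> * R0 i \<omega> * (1 - D i \<omega>)"

(* The two estimators are functions of a realized sample y, r, d, s of units 1..n. *)

definition diff_in_means ::
  "nat \<Rightarrow> (nat \<Rightarrow> real) \<Rightarrow> (nat \<Rightarrow> real) \<Rightarrow> (nat \<Rightarrow> real) \<Rightarrow> real" where
  "diff_in_means n y r d =
     (\<Sum>i=1..n. y i * r i * d i) / (\<Sum>i=1..n. r i * d i) -
     (\<Sum>i=1..n. y i * r i * (1 - d i)) / (\<Sum>i=1..n. r i * (1 - d i))"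

definition sfe_rss ::
  "'s set \<Rightarrow> nat \<Rightarrow> (nat \<Rightarrow> real) \<Rightarrow> (nat \<Rightarrow> real) \<Rightarrow> (nat \<Rightarrow> real) \<Rightarrow> (nat \<Rightarrow> 's) \<Rightarrow>
   real \<Rightarrow> ('s \<Rightarrow> real) \<Rightarrow> real" where
  "sfe_rss Str n y r d s b g =
     (\<Sum>i\<in>{i\<in>{1..n}. r i = 1}. (y i - (b * d i + (\<Sum>t\<in>Str. g t * indicator {t} (s i))))\<^sup>2)"

definition sfe_ols ::
  "'s set \<Rightarrow> nat \<Rightarrow> (nat \<Rightarrow> real) \<Rightarrow> (nat \<Rightarrow> real) \<Rightarrow> (nat \<Rightarrow> real) \<Rightarrow> (nat \<Rightarrow> 's) \<Rightarrow>
   real \<Rightarrow> ('s \<Rightarrow> real) \<Rightarrow> bool" where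
  "sfe_ols Str n y r d s b g \<longleftrightarrow>
     (\<forall>b' g'. sfe_rss Str n y r d s b g \<le> sfe_rss Str n y r d s b' g')"

(* Only the coefficient on d has to be identified: the coefficient of a stratum with no
   observed unit is free.  If the coefficient on d is itself not identified (d is collinear
   with the stratum indicators among the observed units) the value is 0, in line with x / 0 = 0. *)
definition sfe_coef ::
  "'s set \<Rightarrow> nat \<Rightarrow> (nat \<Rightarrow> real) \<Rightarrow> (nat \<Rightarrow> real) \<Rightarrow> (nat \<Rightarrow> real) \<Rightarrow> (nat \<Rightarrow> 's) \<Rightarrow> real" where
  "sfe_coef Str n y r d s =
     (if \<exists>!b. \<exists>g. sfe_ols Str n y r d s b g then THE b. \<exists>g. sfe_ols Str n y r d s b g else 0)"

(* The estimands are functionals of the law of a single unit. *)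

definition theta_obs ::
  "'w measure \<Rightarrow> ('w \<Rightarrow> real) \<Rightarrow> ('w \<Rightarrow> real) \<Rightarrow> ('w \<Rightarrow> real) \<Rightarrow> ('w \<Rightarrow> real) \<Rightarrow> real" where
  "theta_obs M y1 y0 r1 r0 =
     (\<integral>\<omega>. r1 \<omega> * y1 \<omega> \<partial>M) / (\<integral>\<omega>. r1 \<omega> \<partial>M) - (\<integral>\<omega>. r0 \<omega> * y0 \<omega> \<partial>M) / (\<integral>\<omega>. r0 \<omega> \<partial>M)"

(* A stratum in which both response probabilities are 0 has no observed units; it contributes
   0 / 0 = 0 to both expectations. *)
definition theta_sfe ::
  "'w measure \<Rightarrow> 's set \<Rightarrow> real \<Rightarrow> ('w \<Rightarrow> real) \<Rightarrow> ('w \<Rightarrow> real) \<Rightarrow> ('w \<Rightarrow> real) \<Rightarrow> ('w \<Rightarrow> real) \<Rightarrow>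
   ('w \<Rightarrow> 's) \<Rightarrow> real" where
  "theta_sfe M Str \<nu> y1 y0 r1 r0 s =
     (let E = cond_expect M (count_space Str) s in
      inverse (\<integral>\<omega>. (E r1 \<omega> * E r0 \<omega>) / (\<nu> * E r1 \<omega> + (1 - \<nu>) * E r0 \<omega>) \<partial>M) *
      (\<integral>\<omega>. (E (\<lambda>\<omega>'. r1 \<omega>' * y1 \<omega>') \<omega> * E r0 \<omega> - E (\<lambda>\<omega>'. r0 \<omega>' * y0 \<omega>') \<omega> * E r1 \<omega>) /
            (\<nu> * E r1 \<omega> + (1 - \<nu>) * E r0 \<omega>) \<partial>M))"

end

(* Both estimators are rational functions of the stratum-by-arm sample means of f(W_i) I{D_i = d},
   for f = R(d) and f = R(d) Y(d), so everything reduces to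
     (1/n) sum_i f(W_i) I{D_i = d} I{S_i = s}  ->  p_d E[f(W) I{S = s}]  in probability,
   where p_d is nu or 1 - nu.  Replace f by its deviation h from the stratum mean: the
   remainder is a multiple of the treated share of the stratum, which the balance condition
   controls.  For i and j distinct, given S^(n), the product h(W_i) h(W_j) is independent of D^(n) and has
   conditional mean 0, because the W_i stay independent given S^(n).  Hence the summands are
   uncorrelated, for bounded h the mean is O(1/sqrt n) in L2, and truncation gives convergence in
   L1 for integrable f.

   The strata fixed effects coefficient comes from demeaning within strata (Frisch-Waugh). *)
theory Submission
  imports Defs
begin

text \<open>The pairs of W_i and D_i are not independent: D_i may depend on all the labels in S^(n),
  and the assignment for one sample size need not extend that for another. So no law of large
  numbers applies to them directly, and only second moments are at hand. Since there are finitely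
  many strata, S^(n) takes finitely many values, and conditioning reduces to identities on atoms,
  kept in product form so that null atoms do no harm. Truncation spoils a zero stratum mean, so the
  bounded part and the tail are centred afresh, at the price of a factor 2. The other difficulty is
  degeneracy: a stratum may have response probability 0, and even the limiting denominator of the
  fixed effects coefficient may be 0. Division is not continuous there. In these cases the sample
  denominators are 0 almost surely for every n, so sample and limit agree by the convention x / 0 =
  0.\<close>

section \<open>Convergence in probability\<close>

text \<open>Continuity at the limit point suffices, because the event that either coordinate is off
  by more than \<open>d\<close> has vanishing probability. This covers division with a nonzero limit
  below; as \<open>g\<close> may be wild elsewhere, measurability of the composite is a separate
  assumption.\<close>

lemma (in prob_space) tendsto_in_prob_continuous2:
  fixes g :: "real \<Rightarrow> real \<Rightarrow> real"
  assumes X: "tendsto_in_prob M X a" and Y: "tendsto_in_prob M Y b"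
    and g: "isCont (\<lambda>p. g (fst p) (snd p)) (a, b)"
    and meas: "\<And>n. (\<lambda>\<omega>. g (X n \<omega>) (Y n \<omega>)) \<in> borel_measurable M"
  shows "tendsto_in_prob M (\<lambda>n \<omega>. g (X n \<omega>) (Y n \<omega>)) (g a b)"
  unfolding tendsto_in_prob_def
proof (intro conjI allI impI meas)
  fix \<epsilon> :: real assume "0 < \<epsilon>"
  then obtain \<delta> where \<delta>: "\<delta> > 0"
    "\<And>p. dist p (a, b) < \<delta> \<Longrightarrow> dist (g (fst p) (snd p)) (g a b) < \<epsilon>"
    using g by (fastforce simp: continuous_at_eps_delta)
  \<comment> \<open>Two coordinates, each off by at most \<open>d\<close>, put the pair within
    \<open>2 * d\<close> of \<open>(a, b)\<close>; a third instead of a half makes this strictly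
    less than \<open>\<delta>\<close>.\<close>
  define d where "d = \<delta> / 3"
  then have d: "d > 0" "d + d < \<delta>" using \<delta>(1) by auto
  have [measurable]: "X n \<in> borel_measurable M" "Y n \<in> borel_measurable M" for n
    using X Y by (auto simp: tendsto_in_prob_def)
  note [measurable] = meas
  let ?P = "\<lambda>Z c \<epsilon> n. measure M {\<omega> \<in> space M. \<bar>Z n \<omega> - c\<bar> > \<epsilon>}"
  have lim: "(\<lambda>n. ?P X a d n + ?P Y b d n) \<longlonglongrightarrow> 0 + 0"
    using X Y d(1) by (intro tendsto_add) (auto simp: tendsto_in_prob_def)
  have le: "?P (\<lambda>n \<omega>. g (X n \<omega>) (Y n \<omega>)) (g a b) \<epsilon> n \<le> ?P X a d n + ?P Y b d n" for n
  proof -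
    have "\<bar>X n \<omega> - a\<bar> > d \<or> \<bar>Y n \<omega> - b\<bar> > d"
      if "\<bar>g (X n \<omega>) (Y n \<omega>) - g a b\<bar> > \<epsilon>" for \<omega>
    proof (rule ccontr)
      assume "\<not> ?thesis"
      then have "dist (X n \<omega>, Y n \<omega>) (a, b) \<le> d + d"
        unfolding dist_Pair_Pair
        by (intro order.trans[OF sqrt_sum_squares_le_sum]) (auto simp: dist_real_def)
      with d(2) \<delta>(2)[of "(X n \<omega>, Y n \<omega>)"] that show False
        by (auto simp: dist_real_def)
    qed
    then have "?P (\<lambda>n \<omega>. g (X n \<omega>) (Y n \<omega>)) (g a b) \<epsilon> n
      \<le> measure M ({\<omega> \<in> space M. \<bar>X n \<omega> - a\<bar> > d} \<union> {\<omega> \<in> space M. \<bar>Y n \<omega> - b\<bar> > d})"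
      by (intro finite_measure_mono) auto
    also have "\<dots> \<le> ?P X a d n + ?P Y b d n"
      by (intro measure_Un_le) measurable
    finally show ?thesis .
  qed
  show "?P (\<lambda>n \<omega>. g (X n \<omega>) (Y n \<omega>)) (g a b) \<epsilon> \<longlonglongrightarrow> 0"
  proof (rule tendsto_sandwich[OF always_eventually always_eventually tendsto_const])
    show "(\<lambda>n. ?P X a d n + ?P Y b d n) \<longlonglongrightarrow> 0" using lim by simp
  qed (use le in auto)
qed

lemma tendsto_in_prob_measurable:
  "tendsto_in_prob M X a \<Longrightarrow> X n \<in> borel_measurable M"
  by (simp add: tendsto_in_prob_def)

lemma tendsto_in_prob_const: "tendsto_in_prob M (\<lambda>n \<omega>. c) c"
  by (simp add: tendsto_in_prob_def)

lemma (in prob_space) tendsto_in_prob_add: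
  assumes "tendsto_in_prob M X a" "tendsto_in_prob M Y b"
  shows "tendsto_in_prob M (\<lambda>n \<omega>. X n \<omega> + Y n \<omega>) (a + b)"
  using assms[THEN tendsto_in_prob_measurable]
  by (intro tendsto_in_prob_continuous2[OF assms, of "(+)"] continuous_intros) auto

lemma (in prob_space) tendsto_in_prob_diff:
  assumes "tendsto_in_prob M X a" "tendsto_in_prob M Y b"
  shows "tendsto_in_prob M (\<lambda>n \<omega>. X n \<omega> - Y n \<omega>) (a - b)"
  using assms[THEN tendsto_in_prob_measurable]
  by (intro tendsto_in_prob_continuous2[OF assms, of "(-)"] continuous_intros) auto

lemma (in prob_space) tendsto_in_prob_mult:
  assumes "tendsto_in_prob M X a" "tendsto_in_prob M Y b"
  shows "tendsto_in_prob M (\<lambda>n \<omega>. X n \<omega> * Y n \<omega>) (a * b)"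
  using assms[THEN tendsto_in_prob_measurable]
  by (intro tendsto_in_prob_continuous2[OF assms, of "(*)"] continuous_intros) auto

lemma (in prob_space) tendsto_in_prob_divide:
  assumes "tendsto_in_prob M X a" "tendsto_in_prob M Y b" "b \<noteq> 0"
  shows "tendsto_in_prob M (\<lambda>n \<omega>. X n \<omega> / Y n \<omega>) (a / b)"
  using assms(1,2)[THEN tendsto_in_prob_measurable] \<open>b \<noteq> 0\<close>
  by (intro tendsto_in_prob_continuous2[OF assms(1,2), of "(/)"] continuous_intros) auto

lemma (in prob_space) tendsto_in_prob_sum:
  assumes "\<And>k. k \<in> K \<Longrightarrow> tendsto_in_prob M (X k) (a k)"
  shows "tendsto_in_prob M (\<lambda>n \<omega>. \<Sum>k\<in>K. X k n \<omega>) (\<Sum>k\<in>K. a k)"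
  using assms
  by (induction K rule: infinite_finite_induct)
    (auto intro!: tendsto_in_prob_const tendsto_in_prob_add)

text \<open>Serves the degenerate cases, where a ratio equals 0 almost surely and continuity of
  division says nothing.\<close>

lemma tendsto_in_prob_AE_cong:
  assumes "tendsto_in_prob M X a" "\<And>n. AE \<omega> in M. X n \<omega> = Y n \<omega>"
    and "\<And>n. Y n \<in> borel_measurable M"
  shows "tendsto_in_prob M Y a"
proof -
  note [measurable] = tendsto_in_prob_measurable[OF assms(1)] assms(3)
  have "measure M {\<omega> \<in> space M. \<bar>X n \<omega> - a\<bar> > \<epsilon>} = measure M {\<omega> \<in> space M. \<bar>Y n \<omega> - a\<bar> > \<epsilon>}"
    for n \<epsilon> using assms(2)[of n] by (intro measure_eq_AE) auto
  then show ?thesis using assms(1,3) by (simp add: tendsto_in_prob_def)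
qed

lemma tendsto_in_prob_cong:
  assumes "\<And>n \<omega>. \<omega> \<in> space M \<Longrightarrow> X n \<omega> = Y n \<omega>"
  shows "tendsto_in_prob M X a \<longleftrightarrow> tendsto_in_prob M Y a"
proof -
  have "{\<omega> \<in> space M. \<bar>X n \<omega> - a\<bar> > \<epsilon>} = {\<omega> \<in> space M. \<bar>Y n \<omega> - a\<bar> > \<epsilon>}" for n \<epsilon>
    using assms by auto
  moreover have "X n \<in> borel_measurable M \<longleftrightarrow> Y n \<in> borel_measurable M" for n
    using assms by (intro measurable_cong) auto
  ultimately show ?thesis by (simp add: tendsto_in_prob_def)
qed

text \<open>Absorbs the sample size 0, at which \<open>1 / real n\<close> is 0 and identities
  between sample means may fail.\<close>

lemma tendsto_in_prob_eventually:
  assumes "tendsto_in_prob M X a" "\<forall>\<^sub>F n in sequentially. \<forall>\<omega>. X n \<omega> = Y n \<omega>"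
    and "\<And>n. Y n \<in> borel_measurable M"
  shows "tendsto_in_prob M Y a"
  unfolding tendsto_in_prob_def
proof (intro conjI allI impI assms(3))
  fix \<epsilon> :: real assume "0 < \<epsilon>"
  then have "(\<lambda>n. measure M {\<omega> \<in> space M. \<bar>X n \<omega> - a\<bar> > \<epsilon>}) \<longlonglongrightarrow> 0"
    using assms(1) by (auto simp: tendsto_in_prob_def)
  then show "(\<lambda>n. measure M {\<omega> \<in> space M. \<bar>Y n \<omega> - a\<bar> > \<epsilon>}) \<longlonglongrightarrow> 0"
    by (rule Lim_transform_eventually) (use assms(2) in \<open>auto elim!: eventually_mono\<close>)
qed

text \<open>Markov's inequality. L1 is the norm in which the bounded part and the tail of the
  truncation argument can be added up.\<close>

lemma (in prob_space) tendsto_in_prob_L1: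
  assumes int: "\<And>n. integrable M (X n)"
    and lim: "(\<lambda>n. \<integral>\<omega>. \<bar>X n \<omega>\<bar> \<partial>M) \<longlonglongrightarrow> 0"
  shows "tendsto_in_prob M X 0"
  unfolding tendsto_in_prob_def
proof (intro conjI allI impI)
  show m[measurable]: "X n \<in> borel_measurable M" for n using int by auto
  fix \<epsilon> :: real assume \<epsilon>: "0 < \<epsilon>"
  have le: "measure M {\<omega> \<in> space M. \<bar>X n \<omega> - 0\<bar> > \<epsilon>} \<le> (\<integral>\<omega>. \<bar>X n \<omega>\<bar> \<partial>M) / \<epsilon>" for n
  proof -
    have "measure M {\<omega> \<in> space M. \<bar>X n \<omega> - 0\<bar> > \<epsilon>} \<le> measure M {\<omega> \<in> space M. \<epsilon> \<le> \<bar>X n \<omega>\<bar>}"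
      by (intro finite_measure_mono) auto
    also have "\<dots> \<le> (\<integral>\<omega>. \<bar>X n \<omega>\<bar> \<partial>M) / \<epsilon>"
      using integral_Markov_inequality_measure[of M "\<lambda>\<omega>. \<bar>X n \<omega>\<bar>" "{}" \<epsilon>] int \<epsilon> by auto
    finally show ?thesis .
  qed
  show "(\<lambda>n. measure M {\<omega> \<in> space M. \<bar>X n \<omega> - 0\<bar> > \<epsilon>}) \<longlonglongrightarrow> 0"
  proof (rule tendsto_sandwich[OF always_eventually always_eventually tendsto_const])
    show "(\<lambda>n. (\<integral>\<omega>. \<bar>X n \<omega>\<bar> \<partial>M) / \<epsilon>) \<longlonglongrightarrow> 0"
      using tendsto_divide[OF lim tendsto_const[of \<epsilon>]] \<epsilon> by simp
  qed (use le in auto)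
qed

section \<open>Least squares with strata fixed effects\<close>

lemma sum_indicator_stratum:
  assumes "finite Str" "x \<in> Str"
  shows "(\<Sum>t\<in>Str. g t * indicator {t} x) = (g x :: real)"
  using assms by (simp add: indicator_def if_distrib[where f = "\<lambda>z. _ * z"] cong: if_cong)

lemma sum_over_strata:
  assumes "finite Str" "\<And>i. i \<in> I \<Longrightarrow> s i \<in> Str"
  shows "(\<Sum>t\<in>Str. \<Sum>i\<in>I. f i * indicator {t} (s i)) = (\<Sum>i\<in>I. f i :: real)"
proof -
  have "(\<Sum>t\<in>Str. f i * indicator {t} (s i)) = f i" if "i \<in> I" for i
    using assms that by (intro sum_indicator_stratum[of Str "s i" "\<lambda>_. f i"]) auto
  then show ?thesis by (subst sum.swap) (simp cong: sum.cong)
qed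

text \<open>\<open>Q\<close> is the residual sum of squares minimised over the strata coefficients,
  so the regression becomes a quadratic in \<open>b\<close>. Either it is strictly convex with
  vertex \<open>A / B\<close>, or it is constant, the coefficient is not identified, and the default
  0 of \<open>sfe_coef\<close> agrees with \<open>A / 0\<close>.\<close>

lemma sfe_coef_profile:
  assumes le: "\<And>b g. Q b \<le> sfe_rss Str n y r d s b g"
    and eq: "\<And>b. \<exists>g. sfe_rss Str n y r d s b g = Q b"
    and Q: "\<And>b. Q b = C - 2 * b * A + b\<^sup>2 * B"
    and B: "B \<ge> 0" "B = 0 \<Longrightarrow> A = 0"
  shows "sfe_coef Str n y r d s = A / B"
proof -
  have ols: "(\<exists>g. sfe_ols Str n y r d s b g) \<longleftrightarrow> (\<forall>b'. Q b \<le> Q b')" for b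
    unfolding sfe_ols_def by (metis le eq order.trans)
  show ?thesis
  proof (cases "B = 0")
    case True
    then have "\<exists>g. sfe_ols Str n y r d s b g" for b
      unfolding ols Q using B(2) by simp
    \<comment> \<open>Every \<open>b\<close> is a minimiser here, in particular both 0 and
      1.\<close>
    then have "\<not> (\<exists>!b. \<exists>g. sfe_ols Str n y r d s b g)"
      by (metis zero_neq_one)
    with True show ?thesis by (simp add: sfe_coef_def)
  next
    case False
    then have "B > 0" using B(1) by simp
    \<comment> \<open>Completing the square exhibits the minimiser and its uniqueness at
      once.\<close>
    have sq: "Q b = C - A\<^sup>2 / B + B * (b - A / B)\<^sup>2" for b
      using False by (simp add: Q power2_eq_square field_simps)
    have "(\<forall>b'. Q b \<le> Q b') \<longleftrightarrow> b = A / B" for b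
    proof
      assume "\<forall>b'. Q b \<le> Q b'"
      then have "Q b \<le> Q (A / B)" by blast
      then have "B * (b - A / B)\<^sup>2 \<le> 0" by (simp add: sq)
      with \<open>B > 0\<close> show "b = A / B"
        by (metis mult_pos_pos not_le right_minus_eq zero_less_power2)
    qed (use \<open>B > 0\<close> in \<open>simp add: sq\<close>)
    then show ?thesis unfolding sfe_coef_def ols by simp
  qed
qed

text \<open>In the proof, \<open>e\<close> and \<open>x\<close> are outcome and treatment with their
  stratum means among respondents removed, and the coefficient is the slope of \<open>e\<close> on
  \<open>x\<close>. Expressed through arm totals, the formula stays correct when a stratum has no
  respondents, or respondents in one arm only: its summands are then 0.\<close>

lemma sfe_coef_eq:
  fixes y r d :: "nat \<Rightarrow> real"
  assumes Str: "finite Str" and s: "\<And>i. i \<in> {1..n} \<Longrightarrow> s i \<in> Str"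
    and r: "\<And>i. i \<in> {1..n} \<Longrightarrow> r i \<in> {0, 1}"
    and d: "\<And>i. i \<in> {1..n} \<Longrightarrow> d i \<in> {0, 1}"
  defines "N1 \<equiv> \<lambda>t. \<Sum>i=1..n. r i * d i * indicator {t} (s i)"
    and "N0 \<equiv> \<lambda>t. \<Sum>i=1..n. r i * (1 - d i) * indicator {t} (s i)"
    and "T1 \<equiv> \<lambda>t. \<Sum>i=1..n. y i * r i * d i * indicator {t} (s i)"
    and "T0 \<equiv> \<lambda>t. \<Sum>i=1..n. y i * r i * (1 - d i) * indicator {t} (s i)"
  shows "sfe_coef Str n y r d s =
    (\<Sum>t\<in>Str. (T1 t * N0 t - T0 t * N1 t) / (N1 t + N0 t)) /
    (\<Sum>t\<in>Str. N1 t * N0 t / (N1 t + N0 t))"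
proof -
  define m where "m t = N1 t + N0 t" for t
  define yb where "yb t = (T1 t + T0 t) / m t" for t
  define db where "db t = N1 t / m t" for t
  define e where "e i = y i - yb (s i)" for i
  define x where "x i = d i - db (s i)" for i
  have m_eq: "m t = (\<Sum>i=1..n. r i * indicator {t} (s i))" for t
    by (simp add: m_def N1_def N0_def sum.distrib[symmetric] algebra_simps)
  have T_eq: "T1 t + T0 t = (\<Sum>i=1..n. y i * r i * indicator {t} (s i))" for t
    by (simp add: T1_def T0_def sum.distrib[symmetric] algebra_simps)
  have r_nonneg: "0 \<le> r i" if "i \<in> {1..n}" for i
    using r[OF that] by auto
  \<comment> \<open>A vanishing count of respondents forces every single weight to 0, so the means
    \<open>yb\<close> and \<open>db\<close>, which are then 0 by division by 0, do no harm.\<close>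
  have r0: "r i * indicator {t} (s i) = 0" if "m t = 0" "i \<in> {1..n}" for i t
  proof -
    have "\<forall>i\<in>{1..n}. r i * indicator {t} (s i) = 0"
      using \<open>m t = 0\<close> unfolding m_eq
      by (subst (asm) sum_nonneg_eq_0_iff) (use r_nonneg in \<open>auto simp: indicator_def\<close>)
    then show ?thesis using that by blast
  qed
  have z: "\<And>t. m t = 0 \<Longrightarrow> N1 t = 0" "\<And>t. m t = 0 \<Longrightarrow> T1 t + T0 t = 0"
    unfolding T_eq N1_def
    by (intro sum.neutral ballI; use r0 in \<open>fastforce simp: mult.assoc\<close>)+
  have cell_e: "(\<Sum>i=1..n. r i * e i * indicator {t} (s i)) = 0" for t
  proof -
    have "(\<Sum>i=1..n. r i * e i * indicator {t} (s i)) =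
      (\<Sum>i=1..n. y i * r i * indicator {t} (s i) - yb t * (r i * indicator {t} (s i)))"
      by (intro sum.cong refl) (auto simp: e_def indicator_def algebra_simps)
    also have "\<dots> = T1 t + T0 t - yb t * m t"
      by (simp only: sum_subtractf T_eq m_eq sum_distrib_left)
    also have "\<dots> = 0" using z by (cases "m t = 0") (auto simp: yb_def)
    finally show ?thesis .
  qed
  have cell_x: "(\<Sum>i=1..n. r i * x i * indicator {t} (s i)) = 0" for t
  proof -
    have "(\<Sum>i=1..n. r i * x i * indicator {t} (s i)) =
      (\<Sum>i=1..n. r i * d i * indicator {t} (s i) - db t * (r i * indicator {t} (s i)))"
      by (intro sum.cong refl) (auto simp: x_def indicator_def algebra_simps)
    also have "\<dots> = N1 t - db t * m t"
      by (simp only: sum_subtractf N1_def m_eq sum_distrib_left)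
    also have "\<dots> = 0" using z by (cases "m t = 0") (auto simp: db_def)
    finally show ?thesis .
  qed
  \<comment> \<open>A function of the stratum is a combination of stratum indicators, so a residual
    that sums to 0 in each stratum is orthogonal to all such functions.\<close>
  have orth: "(\<Sum>i=1..n. r i * u i * h (s i)) = 0"
    if "\<And>t. (\<Sum>i=1..n. r i * u i * indicator {t} (s i)) = 0" for u h
  proof -
    have "(\<Sum>i=1..n. r i * u i * h (s i)) = (\<Sum>t\<in>Str. \<Sum>i=1..n. r i * u i * h (s i) * indicator {t} (s i))"
      using Str s by (intro sum_over_strata[symmetric]) auto
    also have "\<dots> = (\<Sum>t\<in>Str. h t * (\<Sum>i=1..n. r i * u i * indicator {t} (s i)))"
      by (auto intro!: sum.cong simp only: sum_distrib_left) (simp add: indicator_def)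
    finally show ?thesis by (simp only: that) simp
  qed
  note orth_e = orth[OF cell_e] and orth_x = orth[OF cell_x]
  define A where "A = (\<Sum>i=1..n. r i * e i * x i)"
  define B where "B = (\<Sum>i=1..n. r i * (x i)\<^sup>2)"
  define C where "C = (\<Sum>i=1..n. r i * (e i)\<^sup>2)"
  define Q where "Q b = (\<Sum>i=1..n. r i * (e i - b * x i)\<^sup>2)" for b
  \<comment> \<open>Pythagoras: the deviation from the fit is \<open>e - b * x\<close> plus a
    function of the stratum, and these are orthogonal. The second square vanishes for
    \<open>g = yb - b * db\<close>, so \<open>Q b\<close> is the minimum over
    \<open>g\<close>.\<close>
  have rss: "sfe_rss Str n y r d s b g = Q b + (\<Sum>i=1..n. r i * (yb (s i) - b * db (s i) - g (s i))\<^sup>2)"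
    for b g
  proof -
    let ?h = "\<lambda>t. yb t - b * db t - g t"
    have "sfe_rss Str n y r d s b g = (\<Sum>i=1..n. r i * (y i - (b * d i + g (s i)))\<^sup>2)"
      unfolding sfe_rss_def
    proof (intro sum.mono_neutral_cong_left ballI)
      fix i assume "i \<in> {i \<in> {1..n}. r i = 1}"
      then have "i \<in> {1..n}" "r i = 1" by auto
      then show "(y i - (b * d i + (\<Sum>t\<in>Str. g t * indicator {t} (s i))))\<^sup>2 =
          r i * (y i - (b * d i + g (s i)))\<^sup>2"
        using Str s by (simp only: sum_indicator_stratum)
    next
      fix i assume "i \<in> {1..n} - {i \<in> {1..n}. r i = 1}"
      then have "r i = 0" using r[of i] by auto
      then show "r i * (y i - (b * d i + g (s i)))\<^sup>2 = 0" by simp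
    qed auto
    also have "\<dots> = (\<Sum>i=1..n. r i * (e i - b * x i)\<^sup>2 + r i * (?h (s i))\<^sup>2
        + 2 * (r i * e i * ?h (s i)) - 2 * b * (r i * x i * ?h (s i)))"
      by (intro sum.cong refl) (simp add: e_def x_def power2_eq_square algebra_simps)
    also have "\<dots> = Q b + (\<Sum>i=1..n. r i * (?h (s i))\<^sup>2)
        + 2 * (\<Sum>i=1..n. r i * e i * ?h (s i)) - 2 * b * (\<Sum>i=1..n. r i * x i * ?h (s i))"
      by (simp only: sum.distrib sum_subtractf sum_distrib_left Q_def)
    finally show ?thesis by (simp only: orth_e[of ?h] orth_x[of ?h])
  qed
  have "sfe_coef Str n y r d s = A / B"
  proof (rule sfe_coef_profile)
    show "Q b \<le> sfe_rss Str n y r d s b g" for b g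
      unfolding rss by (simp, intro sum_nonneg mult_nonneg_nonneg) (use r_nonneg in auto)
    show "\<exists>g. sfe_rss Str n y r d s b g = Q b" for b
      by (intro exI[of _ "\<lambda>t. yb t - b * db t"]) (simp add: rss)
    show "Q b = C - 2 * b * A + b\<^sup>2 * B" for b
      by (simp add: Q_def A_def B_def C_def sum_distrib_left sum_subtractf[symmetric]
          sum.distrib[symmetric] power2_eq_square algebra_simps)
    show "B \<ge> 0" unfolding B_def
      by (intro sum_nonneg mult_nonneg_nonneg) (use r_nonneg in auto)
    \<comment> \<open>All weighted treatment residuals are then 0, hence so is each product in
      \<open>A\<close>.\<close>
    assume "B = 0"
    then have "\<forall>i\<in>{1..n}. r i * (x i)\<^sup>2 = 0"
      unfolding B_def by (subst (asm) sum_nonneg_eq_0_iff) (use r_nonneg in auto)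
    then show "A = 0" unfolding A_def by (intro sum.neutral) auto
  qed
  moreover have "A = (\<Sum>t\<in>Str. (T1 t * N0 t - T0 t * N1 t) / (N1 t + N0 t))"
  proof -
    have "A = (\<Sum>i=1..n. r i * e i * d i) - (\<Sum>i=1..n. r i * e i * db (s i))"
      by (simp add: A_def x_def sum_subtractf[symmetric] algebra_simps)
    also have "\<dots> = (\<Sum>t\<in>Str. \<Sum>i=1..n. r i * e i * d i * indicator {t} (s i))"
      using Str s by (simp only: orth_e sum_over_strata diff_zero)
    also have "\<dots> = (\<Sum>t\<in>Str. T1 t - yb t * N1 t)"
      unfolding T1_def N1_def sum_distrib_left sum_subtractf[symmetric]
      by (intro sum.cong refl) (auto simp: e_def indicator_def algebra_simps)
    also have "\<dots> = (\<Sum>t\<in>Str. (T1 t * N0 t - T0 t * N1 t) / (N1 t + N0 t))"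
    proof (intro sum.cong refl)
      fix t
      have "T1 t = 0" if "m t = 0"
        unfolding T1_def by (intro sum.neutral ballI) (use r0[OF that] in \<open>fastforce simp: mult.assoc\<close>)
      then show "T1 t - yb t * N1 t = (T1 t * N0 t - T0 t * N1 t) / (N1 t + N0 t)"
        unfolding yb_def m_def by (cases "N1 t + N0 t = 0") (auto simp: field_simps)
    qed
    finally show ?thesis .
  qed
  moreover have "B = (\<Sum>t\<in>Str. N1 t * N0 t / (N1 t + N0 t))"
  proof -
    have "B = (\<Sum>i=1..n. r i * x i * d i) - (\<Sum>i=1..n. r i * x i * db (s i))"
      by (simp add: B_def x_def sum_subtractf[symmetric] power2_eq_square algebra_simps)
    also have "\<dots> = (\<Sum>t\<in>Str. \<Sum>i=1..n. r i * x i * d i * indicator {t} (s i))"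
      using Str s by (simp only: orth_x sum_over_strata diff_zero)
    also have "\<dots> = (\<Sum>t\<in>Str. N1 t - db t * N1 t)"
    proof (intro sum.cong refl)
      fix t
      \<comment> \<open>Binary treatment makes its raw second moment in a stratum equal to the count
        \<open>N1\<close>.\<close>
      have dd: "d i * d i = d i" if "i \<in> {1..n}" for i using d[OF that] by auto
      have "(\<Sum>i=1..n. r i * x i * d i * indicator {t} (s i)) =
        (\<Sum>i=1..n. r i * (d i * d i) * indicator {t} (s i) - db t * (r i * d i * indicator {t} (s i)))"
        by (intro sum.cong refl) (auto simp: x_def indicator_def algebra_simps)
      also have "\<dots> = (\<Sum>i=1..n. r i * d i * indicator {t} (s i) - db t * (r i * d i * indicator {t} (s i)))"
        by (intro sum.cong refl) (simp only: dd)
      finally show "(\<Sum>i=1..n. r i * x i * d i * indicator {t} (s i)) = N1 t - db t * N1 t"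
        by (simp only: sum_subtractf sum_distrib_left N1_def)
    qed
    also have "\<dots> = (\<Sum>t\<in>Str. N1 t * N0 t / (N1 t + N0 t))"
    proof (intro sum.cong refl)
      fix t
      show "N1 t - db t * N1 t = N1 t * N0 t / (N1 t + N0 t)"
        using z(1)[of t] unfolding db_def m_def
        by (cases "N1 t + N0 t = 0") (auto simp: field_simps)
    qed
    finally show ?thesis .
  qed
  ultimately show ?thesis by simp
qed

section \<open>Conditioning on a discrete variable\<close>

lemma (in prob_space) sigma_finite_sigma_gen:
  assumes "Z \<in> measurable M C"
  shows "sigma_finite_subalgebra M (sigma_gen M C Z)"
proof -
  have "subalgebra M (sigma_gen M C Z)"
    using assms unfolding sigma_gen_def subalgebra_def
    by (auto simp: sets_vimage_algebra2 measurable_sets measurable_space Pi_iff)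
  then show ?thesis
    by (intro finite_measure_subalgebra_is_sigma_finite)
      (auto simp: finite_measure_subalgebra_def finite_measure_subalgebra_axioms_def
        finite_measure_axioms)
qed

text \<open>The chosen version of the conditional expectation is measurable for the sigma-algebra of
  \<open>Z\<close>, hence constant on each fibre of \<open>Z\<close>; this is why the identity holds
  at every point. In product form it is also valid on null fibres.\<close>

lemma (in prob_space) cond_expect_atom:
  assumes Z: "Z \<in> measurable M C" and f: "integrable M f"
    and \<omega>: "\<omega> \<in> space M" and atom: "{Z \<omega>} \<in> sets C"
  shows "cond_expect M C Z f \<omega> * prob {\<omega>' \<in> space M. Z \<omega>' = Z \<omega>} =
    (\<integral>\<omega>'. f \<omega>' * indicator {Z \<omega>} (Z \<omega>') \<partial>M)"
proof -
  let ?F = "sigma_gen M C Z" and ?g = "cond_expect M C Z f"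
  let ?A = "{\<omega>' \<in> space M. Z \<omega>' = Z \<omega>}"
  interpret sigma_finite_subalgebra M ?F by (rule sigma_finite_sigma_gen[OF Z])
  have sets_F: "sets ?F = {Z -` B \<inter> space M |B. B \<in> sets C}"
    using Z unfolding sigma_gen_def by (intro sets_vimage_algebra2) (auto dest: measurable_space)
  have space_F: "space ?F = space M" by (simp add: sigma_gen_def)
  have A: "?A \<in> sets ?F" unfolding sets_F using atom by (auto intro!: exI[of _ "{Z \<omega>}"])
  have [measurable]: "?A \<in> sets M" using A subalg by (auto simp: subalgebra_def)
  \<comment> \<open>The level set of \<open>?g\<close> through \<open>\<omega>\<close> is a preimage
    under \<open>Z\<close>, so it contains the whole fibre of \<open>\<omega>\<close>.\<close>
  have "?g -` {?g \<omega>} \<inter> space ?F \<in> sets ?F"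
    unfolding cond_expect_def by (intro measurable_sets[OF borel_measurable_cond_exp]) auto
  then obtain B where B: "?g -` {?g \<omega>} \<inter> space M = Z -` B \<inter> space M"
    unfolding sets_F space_F by auto
  have const: "?g \<omega>' = ?g \<omega>" if "\<omega>' \<in> ?A" for \<omega>'
  proof -
    have "\<omega> \<in> Z -` B \<inter> space M" using \<omega> unfolding B[symmetric] by simp
    then have "\<omega>' \<in> Z -` B \<inter> space M" using that by simp
    then show ?thesis unfolding B[symmetric] by simp
  qed
  have "(\<integral>\<omega>'. f \<omega>' * indicator {Z \<omega>} (Z \<omega>') \<partial>M) = (\<integral>\<omega>'\<in>?A. f \<omega>' \<partial>M)"
    unfolding set_lebesgue_integral_def by (intro Bochner_Integration.integral_cong) (auto simp: indicator_def)
  also have "\<dots> = (\<integral>\<omega>'\<in>?A. ?g \<omega>' \<partial>M)"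
    unfolding cond_expect_def by (rule real_cond_exp_intA[OF f A])
  also have "\<dots> = (\<integral>\<omega>'\<in>?A. ?g \<omega> \<partial>M)"
    unfolding set_lebesgue_integral_def
    by (intro Bochner_Integration.integral_cong refl) (auto simp: indicator_def const)
  also have "\<dots> = ?g \<omega> * prob ?A"
    by (simp add: set_lebesgue_integral_def)
  finally show ?thesis by simp
qed

text \<open>Elementary conditional independence given the event \<open>Z = z\<close>, with the
  denominators cleared.\<close>

lemma (in prob_space) cond_indep_var_atom:
  assumes ci: "cond_indep_var M A U B V C Z"
    and a: "a \<in> sets A" and b: "b \<in> sets B" and z: "{z} \<in> sets C"
  shows "prob {\<omega> \<in> space M. Z \<omega> = z} * prob {\<omega> \<in> space M. U \<omega> \<in> a \<and> V \<omega> \<in> b \<and> Z \<omega> = z} =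
    prob {\<omega> \<in> space M. V \<omega> \<in> b \<and> Z \<omega> = z} * prob {\<omega> \<in> space M. U \<omega> \<in> a \<and> Z \<omega> = z}"
proof -
  have meas[measurable]: "U \<in> measurable M A" "V \<in> measurable M B" "Z \<in> measurable M C"
    using ci by (auto simp: cond_indep_var_def)
  note [measurable] = a b z
  let ?Z = "{\<omega> \<in> space M. Z \<omega> = z}"
  have Zz: "?Z = {\<omega> \<in> space M. Z \<omega> \<in> {z}}" by auto
  have [measurable]: "?Z \<in> sets M" unfolding Zz by measurable
  show ?thesis
  proof (cases "prob ?Z = 0")
    case True
    have "prob {\<omega> \<in> space M. P \<omega> \<and> Z \<omega> = z} = 0" for P
    proof -
      have "prob {\<omega> \<in> space M. P \<omega> \<and> Z \<omega> = z} \<le> prob ?Z"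
        by (intro finite_measure_mono) auto
      then show ?thesis using True measure_nonneg[of M] by (simp add: order.antisym)
    qed
    from this[of "\<lambda>\<omega>. V \<omega> \<in> b"] True show ?thesis by simp
  next
    case False
    let ?u = "\<lambda>\<omega>. indicator a (U \<omega>) :: real" and ?v = "\<lambda>\<omega>. indicator b (V \<omega>) :: real"
    let ?E = "cond_expect M C Z"
    have "AE \<omega> in M. ?E (\<lambda>\<omega>. ?u \<omega> * ?v \<omega>) \<omega> = ?E ?u \<omega> * ?E ?v \<omega>"
      using ci a b by (auto simp: cond_indep_var_def)
    \<comment> \<open>The factorisation is known almost everywhere only, but an atom of positive
      probability contains a point where it holds, and one point determines the values on the
      atom.\<close>
    then have "\<exists>\<omega>\<in>?Z. ?E (\<lambda>\<omega>. ?u \<omega> * ?v \<omega>) \<omega> = ?E ?u \<omega> * ?E ?v \<omega>"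
    proof (rule contrapos_pp)
      assume neg: "\<not> ?thesis"
      show "\<not> (AE \<omega> in M. ?E (\<lambda>\<omega>. ?u \<omega> * ?v \<omega>) \<omega> = ?E ?u \<omega> * ?E ?v \<omega>)"
      proof
        assume "AE \<omega> in M. ?E (\<lambda>\<omega>. ?u \<omega> * ?v \<omega>) \<omega> = ?E ?u \<omega> * ?E ?v \<omega>"
        then have "AE \<omega> in M. \<omega> \<notin> ?Z" by eventually_elim (use neg in blast)
        then have "prob ?Z = 0"
          by (subst (asm) AE_iff_measurable[of ?Z]) (auto simp: measure_def)
        with False show False ..
      qed
    qed
    then obtain \<omega> where \<omega>: "\<omega> \<in> space M" "Z \<omega> = z"
      and E: "?E (\<lambda>\<omega>. ?u \<omega> * ?v \<omega>) \<omega> = ?E ?u \<omega> * ?E ?v \<omega>" by auto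
    have atP: "?E (indicator {\<omega>. P \<omega>}) \<omega> * prob ?Z = prob {\<omega> \<in> space M. P \<omega> \<and> Z \<omega> = z}"
      if [measurable]: "Measurable.pred M P" for P
    proof -
      have "integrable M (indicator {\<omega>. P \<omega>} :: 'a \<Rightarrow> real)"
      proof (rule Bochner_Integration.integrable_cong[THEN iffD1, rotated 2])
        show "integrable M (indicator {\<omega> \<in> space M. P \<omega>} :: 'a \<Rightarrow> real)"
          by (intro integrable_real_indicator) (auto simp: less_top[symmetric])
      qed (auto simp: indicator_def)
      then have "?E (indicator {\<omega>. P \<omega>}) \<omega> * prob ?Z =
          (\<integral>\<omega>. indicator {\<omega>. P \<omega>} \<omega> * indicator {z} (Z \<omega>) \<partial>M)"
        using cond_expect_atom[OF meas(3) _ \<omega>(1)] z unfolding \<omega>(2) by blast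
      also have "\<dots> = (\<integral>\<omega>. (indicator {\<omega> \<in> space M. P \<omega> \<and> Z \<omega> = z} \<omega> :: real) \<partial>M)"
        by (intro Bochner_Integration.integral_cong) (auto simp: indicator_def)
      also have "\<dots> = prob {\<omega> \<in> space M. P \<omega> \<and> Z \<omega> = z}"
        by (simp add: Int_absorb2)
      finally show ?thesis .
    qed
    have eqs: "?u = indicator {\<omega>. U \<omega> \<in> a}" "?v = indicator {\<omega>. V \<omega> \<in> b}"
      "(\<lambda>\<omega>. ?u \<omega> * ?v \<omega>) = indicator {\<omega>. U \<omega> \<in> a \<and> V \<omega> \<in> b}"
      by (auto simp: indicator_def fun_eq_iff)
    have at: "?E ?u \<omega> * prob ?Z = prob {\<omega> \<in> space M. U \<omega> \<in> a \<and> Z \<omega> = z}"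
      "?E ?v \<omega> * prob ?Z = prob {\<omega> \<in> space M. V \<omega> \<in> b \<and> Z \<omega> = z}"
      "?E (\<lambda>\<omega>. ?u \<omega> * ?v \<omega>) \<omega> * prob ?Z = prob {\<omega> \<in> space M. (U \<omega> \<in> a \<and> V \<omega> \<in> b) \<and> Z \<omega> = z}"
      unfolding eqs by (rule atP, measurable)+
    show ?thesis
      unfolding at[unfolded conj_assoc, symmetric] E by (simp add: mult_ac)
  qed
qed

text \<open>From events to functions without approximation: both sides are integrals of
  \<open>\<phi>\<close> against images under \<open>U\<close> of weighted measures, and
  \<open>cond_indep_var_atom\<close> says that these images agree on every set.\<close>

lemma (in prob_space) cond_indep_var_integral_atom:
  fixes \<phi> :: "'b \<Rightarrow> real"
  assumes ci: "cond_indep_var M A U B V C Z"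
    and b[measurable]: "b \<in> sets B" and z[measurable]: "{z} \<in> sets C"
    and \<phi>[measurable]: "\<phi> \<in> borel_measurable A"
  shows "prob {\<omega> \<in> space M. Z \<omega> = z} * (\<integral>\<omega>. \<phi> (U \<omega>) * indicator b (V \<omega>) * indicator {z} (Z \<omega>) \<partial>M) =
    prob {\<omega> \<in> space M. V \<omega> \<in> b \<and> Z \<omega> = z} * (\<integral>\<omega>. \<phi> (U \<omega>) * indicator {z} (Z \<omega>) \<partial>M)"
proof -
  have [measurable]: "U \<in> measurable M A" "V \<in> measurable M B" "Z \<in> measurable M C"
    using ci by (auto simp: cond_indep_var_def)
  define p where "p = prob {\<omega> \<in> space M. Z \<omega> = z}"
  define q where "q = prob {\<omega> \<in> space M. V \<omega> \<in> b \<and> Z \<omega> = z}"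
  have pq: "p \<ge> 0" "q \<ge> 0" by (simp_all add: p_def q_def)
  let ?w = "\<lambda>\<omega>. p * (indicator b (V \<omega>) * indicator {z} (Z \<omega>)) :: real"
  let ?w' = "\<lambda>\<omega>. q * indicator {z} (Z \<omega>) :: real"
  have em: "emeasure (distr (density M (\<lambda>\<omega>. ennreal (c * indicator {\<omega>. P \<omega>} \<omega>))) A U) a =
      ennreal (c * prob {\<omega> \<in> space M. U \<omega> \<in> a \<and> P \<omega>})"
    if [measurable]: "a \<in> sets A" "Measurable.pred M P" and c: "c \<ge> 0" for a P c
  proof -
    have "emeasure (distr (density M (\<lambda>\<omega>. ennreal (c * indicator {\<omega>. P \<omega>} \<omega>))) A U) a =
      (\<integral>\<^sup>+\<omega>. ennreal (c * indicator {\<omega>. P \<omega>} \<omega>) * indicator (U -` a \<inter> space M) \<omega> \<partial>M)"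
      by (simp add: emeasure_distr emeasure_density)
    also have "\<dots> = (\<integral>\<^sup>+\<omega>. ennreal c * indicator {\<omega> \<in> space M. U \<omega> \<in> a \<and> P \<omega>} \<omega> \<partial>M)"
      by (intro nn_integral_cong) (auto simp: indicator_def)
    also have "\<dots> = ennreal (c * prob {\<omega> \<in> space M. U \<omega> \<in> a \<and> P \<omega>})"
      using c by (simp add: nn_integral_cmult_indicator emeasure_eq_measure ennreal_mult)
    finally show ?thesis .
  qed
  have w: "p * (indicator b (V \<omega>) * indicator {z} (Z \<omega>)) = p * indicator {\<omega>. V \<omega> \<in> b \<and> Z \<omega> = z} \<omega>"
    "q * indicator {z} (Z \<omega>) = q * indicator {\<omega>. Z \<omega> = z} \<omega>" for \<omega>
    by (auto simp: indicator_def)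
  have Zz[measurable]: "Measurable.pred M (\<lambda>\<omega>. Z \<omega> = z)"
  proof -
    have "Measurable.pred M (\<lambda>\<omega>. Z \<omega> \<in> {z})" by measurable
    then show ?thesis by simp
  qed
  have VZ: "Measurable.pred M (\<lambda>\<omega>. V \<omega> \<in> b \<and> Z \<omega> = z)" by measurable
  have "distr (density M ?w) A U = distr (density M ?w') A U"
  proof (rule measure_eqI)
    fix a assume "a \<in> sets (distr (density M ?w) A U)"
    then have a: "a \<in> sets A" by simp
    show "emeasure (distr (density M ?w) A U) a = emeasure (distr (density M ?w') A U) a"
      using cond_indep_var_atom[OF ci a b z]
      unfolding w em[OF a VZ pq(1)] em[OF a Zz pq(2)] by (simp add: p_def q_def)
  qed simp
  then have "integral\<^sup>L (distr (density M ?w) A U) \<phi> = integral\<^sup>L (distr (density M ?w') A U) \<phi>"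
    by simp
  then have "(\<integral>\<omega>. p * (\<phi> (U \<omega>) * indicator b (V \<omega>) * indicator {z} (Z \<omega>)) \<partial>M) =
    (\<integral>\<omega>. q * (\<phi> (U \<omega>) * indicator {z} (Z \<omega>)) \<partial>M)"
    using pq by (simp add: integral_distr integral_density mult_ac)
  then show ?thesis by (simp add: p_def q_def)
qed

lemma (in prob_space) integral_split_finite_range:
  fixes f :: "'a \<Rightarrow> real"
  assumes K: "finite K" "\<And>\<omega>. \<omega> \<in> space M \<Longrightarrow> Z \<omega> \<in> K"
    and int: "integrable M f"
    and atom: "\<And>z. z \<in> K \<Longrightarrow> {\<omega> \<in> space M. Z \<omega> = z} \<in> sets M"
  shows "(\<integral>\<omega>. f \<omega> \<partial>M) = (\<Sum>z\<in>K. \<integral>\<omega>. f \<omega> * indicator {z} (Z \<omega>) \<partial>M)"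
proof -
  have int': "integrable M (\<lambda>\<omega>. f \<omega> * indicator {z} (Z \<omega>))" if "z \<in> K" for z
  proof -
    have "integrable M (\<lambda>\<omega>. f \<omega> * indicator {\<omega> \<in> space M. Z \<omega> = z} \<omega>)"
      using int atom[OF that] by (intro integrable_real_mult_indicator) auto
    then show ?thesis
      by (rule Bochner_Integration.integrable_cong[THEN iffD1, rotated 2]) (auto simp: indicator_def)
  qed
  have "(\<integral>\<omega>. f \<omega> \<partial>M) = (\<integral>\<omega>. (\<Sum>z\<in>K. f \<omega> * indicator {z} (Z \<omega>)) \<partial>M)"
    using K by (intro Bochner_Integration.integral_cong refl) (auto simp: indicator_def if_distrib cong: if_cong)
  also have "\<dots> = (\<Sum>z\<in>K. \<integral>\<omega>. f \<omega> * indicator {z} (Z \<omega>) \<partial>M)"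
    using int' by (intro Bochner_Integration.integral_sum) auto
  finally show ?thesis .
qed

text \<open>Stands in for the tower property: the integral vanishes atom by atom, whatever event is
  imposed on \<open>V\<close>.\<close>

lemma (in prob_space) cond_indep_var_uncorrelated:
  fixes \<phi> :: "'b \<Rightarrow> real"
  assumes ci: "cond_indep_var M A U B V C Z"
    and K: "finite K" "\<And>\<omega>. \<omega> \<in> space M \<Longrightarrow> Z \<omega> \<in> K" "\<And>z. z \<in> K \<Longrightarrow> {z} \<in> sets C"
    and b[measurable]: "b \<in> sets B" and \<phi>[measurable]: "\<phi> \<in> borel_measurable A"
    and int: "integrable M (\<lambda>\<omega>. \<phi> (U \<omega>))"
    and zero: "\<And>z. z \<in> K \<Longrightarrow> (\<integral>\<omega>. \<phi> (U \<omega>) * indicator {z} (Z \<omega>) \<partial>M) = 0"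
  shows "(\<integral>\<omega>. \<phi> (U \<omega>) * indicator b (V \<omega>) \<partial>M) = 0"
proof -
  have [measurable]: "U \<in> measurable M A" "V \<in> measurable M B" "Z \<in> measurable M C"
    using ci by (auto simp: cond_indep_var_def)
  have atom: "{\<omega> \<in> space M. Z \<omega> = z} \<in> sets M" if "z \<in> K" for z
  proof -
    note [measurable] = K(3)[OF that]
    have "{\<omega> \<in> space M. Z \<omega> \<in> {z}} \<in> sets M" by measurable
    then show ?thesis by simp
  qed
  have "integrable M (\<lambda>\<omega>. \<phi> (U \<omega>) * indicator b (V \<omega>))"
    by (rule Bochner_Integration.integrable_bound[OF int]) (auto simp: indicator_def)
  then have "(\<integral>\<omega>. \<phi> (U \<omega>) * indicator b (V \<omega>) \<partial>M) =
    (\<Sum>z\<in>K. \<integral>\<omega>. \<phi> (U \<omega>) * indicator b (V \<omega>) * indicator {z} (Z \<omega>) \<partial>M)"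
    using K atom by (intro integral_split_finite_range) auto
  also have "\<dots> = 0"
  proof (intro sum.neutral ballI)
    fix z assume z: "z \<in> K"
    show "(\<integral>\<omega>. \<phi> (U \<omega>) * indicator b (V \<omega>) * indicator {z} (Z \<omega>) \<partial>M) = 0"
    \<comment> \<open>The product identity can be cancelled only on an atom of positive probability;
      on a null atom the integrand is 0 almost everywhere.\<close>
    proof (cases "prob {\<omega> \<in> space M. Z \<omega> = z} = 0")
      case True
      then have "AE \<omega> in M. Z \<omega> \<noteq> z"
        using atom[OF z] by (subst AE_iff_measurable[OF atom[OF z]]) (auto simp: emeasure_eq_measure)
      then show ?thesis
        by (intro integral_eq_zero_AE) (auto elim!: eventually_mono simp: indicator_def)
    next
      case False
      then show ?thesis
        using cond_indep_var_integral_atom[OF ci b K(3)[OF z] \<phi>] zero[OF z] by simp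
    qed
  qed
  finally show ?thesis .
qed

section \<open>A weak law under stratified assignment\<close>

text \<open>The variance of the absolute value of \<open>X\<close> is nonnegative.\<close>

lemma (in prob_space) expectation_abs_power2_le:
  fixes X :: "'a \<Rightarrow> real"
  assumes "integrable M X" "integrable M (\<lambda>\<omega>. (X \<omega>)\<^sup>2)"
  shows "(\<integral>\<omega>. \<bar>X \<omega>\<bar> \<partial>M)\<^sup>2 \<le> (\<integral>\<omega>. (X \<omega>)\<^sup>2 \<partial>M)"
  using variance_eq[of "\<lambda>\<omega>. \<bar>X \<omega>\<bar>"] variance_positive[of "\<lambda>\<omega>. \<bar>X \<omega>\<bar>"] assms by simp

text \<open>Only the n diagonal terms of the squared sum survive, each of mean at most
  \<open>K\<^sup>2\<close>; division by the square of n leaves \<open>K\<^sup>2 / real n\<close>.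
  For n = 0 both sides are 0.\<close>

lemma (in prob_space) expectation_abs_mean_uncorrelated:
  fixes \<xi> :: "nat \<Rightarrow> 'a \<Rightarrow> real"
  assumes meas: "\<And>i. i \<in> {1..n} \<Longrightarrow> \<xi> i \<in> borel_measurable M"
    and bound: "\<And>i \<omega>. i \<in> {1..n} \<Longrightarrow> \<omega> \<in> space M \<Longrightarrow> \<bar>\<xi> i \<omega>\<bar> \<le> K"
    and K: "K \<ge> 0"
    and uncorr: "\<And>i j. i \<in> {1..n} \<Longrightarrow> j \<in> {1..n} \<Longrightarrow> i \<noteq> j \<Longrightarrow> (\<integral>\<omega>. \<xi> i \<omega> * \<xi> j \<omega> \<partial>M) = 0"
  shows "(\<integral>\<omega>. \<bar>1 / real n * (\<Sum>i=1..n. \<xi> i \<omega>)\<bar> \<partial>M) \<le> K / sqrt (real n)"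
proof (cases "n = 0")
  case False
  let ?X = "\<lambda>\<omega>. 1 / real n * (\<Sum>i=1..n. \<xi> i \<omega>)"
  have int_prod: "integrable M (\<lambda>\<omega>. \<xi> i \<omega> * \<xi> j \<omega>)" if "i \<in> {1..n}" "j \<in> {1..n}" for i j
    using meas bound that K
    by (intro integrable_const_bound[where B = "K * K"]) (auto simp: abs_mult intro!: mult_mono)
  have int: "integrable M (\<xi> i)" if "i \<in> {1..n}" for i
    using meas bound that by (intro integrable_const_bound[where B = K]) auto
  have sq: "(?X \<omega>)\<^sup>2 = 1 / (real n)\<^sup>2 * (\<Sum>i=1..n. \<Sum>j=1..n. \<xi> i \<omega> * \<xi> j \<omega>)" for \<omega>
    by (simp add: power2_eq_square sum_product)
  have "(\<integral>\<omega>. (?X \<omega>)\<^sup>2 \<partial>M) = 1 / (real n)\<^sup>2 * (\<Sum>i=1..n. \<Sum>j=1..n. \<integral>\<omega>. \<xi> i \<omega> * \<xi> j \<omega> \<partial>M)"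
    unfolding sq integral_mult_right_zero
    by (subst Bochner_Integration.integral_sum, intro Bochner_Integration.integrable_sum int_prod)
      (auto intro!: sum.cong Bochner_Integration.integral_sum int_prod)
  also have "\<dots> \<le> 1 / (real n)\<^sup>2 * (\<Sum>i=1..n. \<Sum>j=1..n. if i = j then K * K else 0)"
  proof (intro mult_left_mono sum_mono)
    fix i j assume ij: "i \<in> {1..n}" "j \<in> {1..n}"
    have "(\<integral>\<omega>. \<xi> i \<omega> * \<xi> j \<omega> \<partial>M) \<le> (\<integral>\<omega>. K * K \<partial>M)"
    proof (rule integral_mono[OF int_prod[OF ij]])
      fix \<omega> assume \<omega>: "\<omega> \<in> space M"
      have "\<xi> i \<omega> * \<xi> j \<omega> \<le> \<bar>\<xi> i \<omega>\<bar> * \<bar>\<xi> j \<omega>\<bar>" by (metis abs_ge_self abs_mult)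
      also have "\<dots> \<le> K * K" using bound[OF ij(1) \<omega>] bound[OF ij(2) \<omega>] K by (intro mult_mono) auto
      finally show "\<xi> i \<omega> * \<xi> j \<omega> \<le> K * K" .
    qed simp
    then show "(\<integral>\<omega>. \<xi> i \<omega> * \<xi> j \<omega> \<partial>M) \<le> (if i = j then K * K else 0)"
      using uncorr[OF ij] by (auto simp: prob_space)
  qed simp
  also have "\<dots> = K\<^sup>2 / real n"
    using False by (simp add: power2_eq_square)
  finally have *: "(\<integral>\<omega>. (?X \<omega>)\<^sup>2 \<partial>M) \<le> K\<^sup>2 / real n" .
  have "integrable M (\<lambda>\<omega>. (?X \<omega>)\<^sup>2)" unfolding sq
    by (intro integrable_mult_right Bochner_Integration.integrable_sum int_prod)
  moreover have "integrable M ?X"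
    by (intro integrable_mult_right Bochner_Integration.integrable_sum int)
  ultimately have "(\<integral>\<omega>. \<bar>?X \<omega>\<bar> \<partial>M)\<^sup>2 \<le> (\<integral>\<omega>. (?X \<omega>)\<^sup>2 \<partial>M)"
    by (intro expectation_abs_power2_le)
  with * have "(\<integral>\<omega>. \<bar>?X \<omega>\<bar> \<partial>M)\<^sup>2 \<le> K\<^sup>2 / real n" by simp
  then have "(\<integral>\<omega>. \<bar>?X \<omega>\<bar> \<partial>M) \<le> sqrt (K\<^sup>2 / real n)" by (rule real_le_rsqrt)
  also have "\<dots> = K / sqrt (real n)" using K by (simp add: real_sqrt_divide)
  finally show ?thesis .
qed simp

text \<open>The datum of a unit is an abstract random element of \<open>N\<close>, and its stratum a
  function \<open>\<sigma>\<close> of it. \<open>D n i\<close> carries two indices because each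
  sample size has its own assignment. The balance condition is added in
  \<open>attrition_experiment\<close>.\<close>

locale stratified_assignment = prob_space M for M :: "'w measure" +
  fixes N :: "'a measure" and W :: "nat \<Rightarrow> 'w \<Rightarrow> 'a" and Str :: "'s set" and \<sigma> :: "'a \<Rightarrow> 's"
    and D :: "nat \<Rightarrow> nat \<Rightarrow> 'w \<Rightarrow> real"
  assumes indep: "indep_vars (\<lambda>_. N) W {1..}"
    and ident: "\<And>i. i \<ge> 1 \<Longrightarrow> distr M N (W i) = distr M N (W 1)"
    and finite_Str: "finite Str"
    and measurable_stratum: "\<sigma> \<in> measurable N (count_space Str)"
    and cond_indep: "\<And>n. cond_indep_var M
          (Pi\<^sub>M {1..n} (\<lambda>_. N)) (\<lambda>\<omega>. \<lambda>i\<in>{1..n}. W i \<omega>)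
          (Pi\<^sub>M {1..n} (\<lambda>_. borel)) (\<lambda>\<omega>. \<lambda>i\<in>{1..n}. D n i \<omega>)
          (Pi\<^sub>M {1..n} (\<lambda>_. count_space Str)) (\<lambda>\<omega>. \<lambda>i\<in>{1..n}. \<sigma> (W i \<omega>))"
begin

lemma measurable_W: "i \<ge> 1 \<Longrightarrow> W i \<in> measurable M N"
  using indep by (auto simp: indep_vars_def)

lemma measurable_W1[measurable]: "W 1 \<in> measurable M N" "W (Suc 0) \<in> measurable M N"
  using measurable_W[of 1] by auto

lemma measurable_D: "i \<in> {1..n} \<Longrightarrow> D n i \<in> borel_measurable M"
proof -
  assume i: "i \<in> {1..n}"
  have "(\<lambda>\<omega>. \<lambda>i\<in>{1..n}. D n i \<omega>) \<in> measurable M (Pi\<^sub>M {1..n} (\<lambda>_. borel))"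
    using cond_indep[of n] by (simp add: cond_indep_var_def)
  from measurable_component_singleton[OF i, THEN measurable_compose[OF this]] i
  show ?thesis by simp
qed

lemma stratum_in_Str: "i \<ge> 1 \<Longrightarrow> \<omega> \<in> space M \<Longrightarrow> \<sigma> (W i \<omega>) \<in> Str"
  using measurable_space[OF measurable_W] measurable_space[OF measurable_stratum] by fastforce

lemma measurable_stratum_indicator[measurable]:
  "(\<lambda>w. indicator {s} (\<sigma> w) :: real) \<in> borel_measurable N"
proof (cases "s \<in> Str")
  case True
  show ?thesis
    by (rule measurable_compose[OF measurable_stratum]) simp
next
  case False
  \<comment> \<open>The singleton \<open>{s}\<close> is not measurable in
    \<open>count_space Str\<close> here, but no point of \<open>N\<close> has this label, so the
    indicator is 0 on the whole space.\<close>
  then have "(\<lambda>w. indicator {s} (\<sigma> w) :: real) \<in> borel_measurable N \<longleftrightarrow> (\<lambda>_. 0 :: real) \<in> borel_measurable N"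
    using measurable_space[OF measurable_stratum] by (intro measurable_cong) (auto simp: indicator_def)
  then show ?thesis by simp
qed

lemma measurable_of_W: "i \<ge> 1 \<Longrightarrow> f \<in> borel_measurable N \<Longrightarrow> (\<lambda>\<omega>. f (W i \<omega>)) \<in> borel_measurable M"
  for f :: "'a \<Rightarrow> real"
  using measurable_compose[OF measurable_W] .

lemma integrable_W_iff:
  fixes f :: "'a \<Rightarrow> real"
  assumes "i \<ge> 1" "f \<in> borel_measurable N"
  shows "integrable M (\<lambda>\<omega>. f (W i \<omega>)) \<longleftrightarrow> integrable M (\<lambda>\<omega>. f (W 1 \<omega>))"
  using integrable_distr_eq[OF measurable_W, of i f] integrable_distr_eq[OF measurable_W, of 1 f]
    ident[of i] assms by simp

lemma integral_W:
  fixes f :: "'a \<Rightarrow> real"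
  assumes "i \<ge> 1" "f \<in> borel_measurable N"
  shows "(\<integral>\<omega>. f (W i \<omega>) \<partial>M) = (\<integral>\<omega>. f (W 1 \<omega>) \<partial>M)"
  using integral_distr[OF measurable_W, of i f] integral_distr[OF measurable_W, of 1 f]
    ident[of i] assms by simp

lemma integrable_of_W_bounded:
  fixes h :: "'a \<Rightarrow> real"
  assumes "i \<ge> 1" "h \<in> borel_measurable N" "\<And>w. w \<in> space N \<Longrightarrow> \<bar>h w\<bar> \<le> K"
  shows "integrable M (\<lambda>\<omega>. h (W i \<omega>))"
  using assms measurable_of_W measurable_space[OF measurable_W]
  by (intro integrable_const_bound[where B = K]) auto

text \<open>Given all the labels, conditional independence removes the assignment, and what remains
  is an integral over an atom that factorises over units. The factor of unit i is 0 by the centring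
  hypothesis \<open>zero\<close>. The set \<open>B\<close> selects the arm.\<close>

lemma stratum_centred_uncorrelated:
  fixes h :: "'a \<Rightarrow> real"
  assumes h[measurable]: "h \<in> borel_measurable N" and K: "\<And>w. w \<in> space N \<Longrightarrow> \<bar>h w\<bar> \<le> K"
    and zero: "\<And>t. t \<in> Str \<Longrightarrow> (\<integral>\<omega>. h (W 1 \<omega>) * indicator {t} (\<sigma> (W 1 \<omega>)) \<partial>M) = 0"
    and ij: "i \<in> {1..n}" "j \<in> {1..n}" "i \<noteq> j" and B[measurable]: "B \<in> sets borel"
  shows "(\<integral>\<omega>. (indicator B (D n i \<omega>) * h (W i \<omega>)) * (indicator B (D n j \<omega>) * h (W j \<omega>)) \<partial>M) = 0"
proof -
  let ?U = "\<lambda>\<omega>. \<lambda>i\<in>{1..n}. W i \<omega>" and ?V = "\<lambda>\<omega>. \<lambda>i\<in>{1..n}. D n i \<omega>"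
    and ?Z = "\<lambda>\<omega>. \<lambda>i\<in>{1..n}. \<sigma> (W i \<omega>)"
  let ?b = "{v \<in> space (Pi\<^sub>M {1..n} (\<lambda>_. borel)). v i \<in> B \<and> v j \<in> B}"
  let ?\<phi> = "\<lambda>u. h (u i) * h (u j)"
  have Kbound: "\<bar>h (W k \<omega>)\<bar> \<le> K" if "k \<in> {1..n}" "\<omega> \<in> space M" for k \<omega>
    using K measurable_space[OF measurable_W] that by auto
  have "K \<ge> 0" using Kbound[OF ij(1)] not_empty abs_ge_zero order.trans by blast
  have int_h: "integrable M (\<lambda>\<omega>. h (W k \<omega>))" if "k \<in> {1..n}" for k
    using K that by (intro integrable_of_W_bounded) auto
  have "(\<integral>\<omega>. ?\<phi> (?U \<omega>) * indicator ?b (?V \<omega>) \<partial>M) = 0"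
  proof (rule cond_indep_var_uncorrelated[OF cond_indep])
    show "finite ({1..n} \<rightarrow>\<^sub>E Str)" using finite_Str by (intro finite_PiE) auto
    show "?Z \<omega> \<in> {1..n} \<rightarrow>\<^sub>E Str" if "\<omega> \<in> space M" for \<omega>
      using that stratum_in_Str by auto
    show "{z} \<in> sets (Pi\<^sub>M {1..n} (\<lambda>_. count_space Str))" if "z \<in> {1..n} \<rightarrow>\<^sub>E Str" for z
    proof -
      \<comment> \<open>Only finitely many units are involved, so an atom is a finite product of
        singletons and thus measurable.\<close>
      have "{z} = Pi\<^sub>E {1..n} (\<lambda>i. {z i})"
        using that by (subst PiE_singleton) (auto simp: PiE_def)
      also have "\<dots> \<in> sets (Pi\<^sub>M {1..n} (\<lambda>_. count_space Str))"
        using that by (intro sets_PiM_I_finite) auto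
      finally show ?thesis .
    qed
    show "?b \<in> sets (Pi\<^sub>M {1..n} (\<lambda>_. borel))" using ij by measurable
    show "?\<phi> \<in> borel_measurable (Pi\<^sub>M {1..n} (\<lambda>_. N))"
      using ij by measurable
    show "integrable M (\<lambda>\<omega>. ?\<phi> (?U \<omega>))"
      using ij Kbound \<open>K \<ge> 0\<close> borel_measurable_integrable[OF int_h]
      by (intro integrable_const_bound[where B = "K * K"]) (auto simp: abs_mult intro!: mult_mono)
    fix z assume z: "z \<in> {1..n} \<rightarrow>\<^sub>E Str"
    \<comment> \<open>The indicator of the atom is a product of one indicator per unit; attaching
      \<open>h\<close> to the units i and j turns the integrand into a product of functions of
      independent data.\<close>
    define g where "g k w = (if k \<in> {i, j} then h w else 1) * indicator {z k} (\<sigma> w)" for k w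
    have gm[measurable]: "g k \<in> borel_measurable N" for k unfolding g_def by measurable
    have prod: "?\<phi> (?U \<omega>) * indicator {z} (?Z \<omega>) = (\<Prod>k\<in>{1..n}. g k (W k \<omega>))" for \<omega>
    proof -
      have "(\<Prod>k\<in>{1..n}. if k \<in> {i, j} then h (W k \<omega>) else 1) = (\<Prod>k\<in>{i, j}. h (W k \<omega>))"
        using ij by (intro prod.mono_neutral_cong_right) auto
      moreover have "(\<Prod>k\<in>{1..n}. indicator {z k} (\<sigma> (W k \<omega>))) = (indicator {z} (?Z \<omega>) :: real)"
      proof (cases "\<forall>k\<in>{1..n}. \<sigma> (W k \<omega>) = z k")
        case True
        then have "?Z \<omega> = z" using z by (auto simp: fun_eq_iff PiE_def extensional_def)
        with True show ?thesis by simp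
      next
        case False
        then obtain k where k: "k \<in> {1..n}" "\<sigma> (W k \<omega>) \<noteq> z k" by blast
        have "?Z \<omega> \<noteq> z"
        proof
          assume "?Z \<omega> = z"
          from fun_cong[OF this, of k] k show False by simp
        qed
        moreover have "(\<Prod>k\<in>{1..n}. indicator {z k} (\<sigma> (W k \<omega>))) = (0 :: real)"
          using k by (intro prod_zero bexI[of _ k]) auto
        ultimately show ?thesis by simp
      qed
      ultimately have "(\<Prod>k\<in>{1..n}. g k (W k \<omega>)) = (\<Prod>k\<in>{i, j}. h (W k \<omega>)) * indicator {z} (?Z \<omega>)"
        unfolding g_def prod.distrib by (simp only:)
      then show ?thesis using ij by simp
    qed
    have "indep_vars (\<lambda>_. borel) (\<lambda>k \<omega>. g k (W k \<omega>)) {1..n}"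
      by (rule indep_vars_compose2[OF indep_vars_subset[OF indep]]) auto
    moreover have "integrable M (\<lambda>\<omega>. g k (W k \<omega>))" if "k \<in> {1..n}" for k
    proof (rule integrable_of_W_bounded[OF _ gm])
      show "1 \<le> k" using that by simp
      fix w assume "w \<in> space N"
      \<comment> \<open>Units other than i and j carry the factor 1, whence the bound
        \<open>max 1 K\<close>.\<close>
      from K[OF this] \<open>K \<ge> 0\<close> show "\<bar>g k w\<bar> \<le> max 1 K"
        unfolding g_def by (simp add: indicator_def le_max_iff_disj)
    qed
    ultimately have "(\<integral>\<omega>. ?\<phi> (?U \<omega>) * indicator {z} (?Z \<omega>) \<partial>M) = (\<Prod>k\<in>{1..n}. \<integral>\<omega>. g k (W k \<omega>) \<partial>M)"
      unfolding prod by (intro indep_vars_lebesgue_integral) auto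
    also have "(\<integral>\<omega>. g i (W i \<omega>) \<partial>M) = 0"
      using zero[OF PiE_mem[OF z ij(1)]] integral_W[OF _ gm, of i i] ij by (simp add: g_def)
    then have "(\<Prod>k\<in>{1..n}. \<integral>\<omega>. g k (W k \<omega>) \<partial>M) = 0"
      using ij by (intro prod_zero) auto
    finally show "(\<integral>\<omega>. ?\<phi> (?U \<omega>) * indicator {z} (?Z \<omega>) \<partial>M) = 0" .
  qed
  moreover have "?\<phi> (?U \<omega>) * indicator ?b (?V \<omega>) =
      (indicator B (D n i \<omega>) * h (W i \<omega>)) * (indicator B (D n j \<omega>) * h (W j \<omega>))" for \<omega>
    using ij by (auto simp: indicator_def space_PiM)
  ultimately show ?thesis by simp
qed

section \<open>Stratum probabilities, stratum means and centring\<close>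

definition stratum_prob :: "'s \<Rightarrow> real" where
  "stratum_prob s = (\<integral>\<omega>. indicator {s} (\<sigma> (W 1 \<omega>)) \<partial>M)"

definition stratum_mean :: "'s \<Rightarrow> ('a \<Rightarrow> real) \<Rightarrow> real" where
  "stratum_mean s f = (\<integral>\<omega>. f (W 1 \<omega>) * indicator {s} (\<sigma> (W 1 \<omega>)) \<partial>M) / stratum_prob s"

text \<open>The indicator confines the deviation to stratum \<open>s\<close>, so that its sum over
  an arm is the cell total minus the stratum mean times the cell count.\<close>

definition stratum_centred :: "'s \<Rightarrow> ('a \<Rightarrow> real) \<Rightarrow> 'a \<Rightarrow> real" where
  "stratum_centred s f w = (f w - stratum_mean s f) * indicator {s} (\<sigma> w)"

lemma stratum_prob_nonneg: "stratum_prob s \<ge> 0"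
  by (simp add: stratum_prob_def)

lemma integrable_stratum_indicator: "integrable M (\<lambda>\<omega>. indicator {s} (\<sigma> (W 1 \<omega>)) :: real)"
  by (rule integrable_of_W_bounded[OF _ measurable_stratum_indicator, where K = 1])
    (simp_all add: indicator_def)

lemma integrable_times_stratum:
  fixes f :: "'a \<Rightarrow> real"
  assumes "integrable M (\<lambda>\<omega>. f (W 1 \<omega>))"
  shows "integrable M (\<lambda>\<omega>. f (W 1 \<omega>) * indicator {s} (\<sigma> (W 1 \<omega>)))"
proof (rule Bochner_Integration.integrable_bound[OF assms])
  show "(\<lambda>\<omega>. f (W 1 \<omega>) * indicator {s} (\<sigma> (W 1 \<omega>))) \<in> borel_measurable M"
    using assms by (intro borel_measurable_times measurable_compose[OF measurable_W1(1)
          measurable_stratum_indicator]) auto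
qed (auto simp: indicator_def)

text \<open>In a null stratum the mean is 0 by division by 0 and the integral is 0 because the
  indicator vanishes almost surely, so the mean can be multiplied back for every label.\<close>

lemma stratum_integral_eq:
  fixes f :: "'a \<Rightarrow> real"
  assumes f: "integrable M (\<lambda>\<omega>. f (W 1 \<omega>))"
  shows "(\<integral>\<omega>. f (W 1 \<omega>) * indicator {s} (\<sigma> (W 1 \<omega>)) \<partial>M) = stratum_mean s f * stratum_prob s"
proof (cases "stratum_prob s = 0")
  case True
  then have "AE \<omega> in M. indicator {s} (\<sigma> (W 1 \<omega>)) = (0 :: real)"
    unfolding stratum_prob_def
    by (subst (asm) integral_nonneg_eq_0_iff_AE[OF integrable_stratum_indicator]) auto
  then have "(\<integral>\<omega>. f (W 1 \<omega>) * indicator {s} (\<sigma> (W 1 \<omega>)) \<partial>M) = 0"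
    by (intro integral_eq_zero_AE) (auto elim!: eventually_mono)
  with True show ?thesis by simp
qed (simp add: stratum_mean_def)

lemma measurable_stratum_centred[measurable]:
  "f \<in> borel_measurable N \<Longrightarrow> stratum_centred s f \<in> borel_measurable N"
  unfolding stratum_centred_def
  by (intro borel_measurable_times borel_measurable_diff borel_measurable_const
      measurable_stratum_indicator)

lemma integrable_stratum_centred:
  assumes "integrable M (\<lambda>\<omega>. f (W 1 \<omega>))"
  shows "integrable M (\<lambda>\<omega>. stratum_centred s f (W 1 \<omega>))"
  using integrable_times_stratum[OF assms, of s] integrable_stratum_indicator[of s]
  by (simp add: stratum_centred_def left_diff_distrib)

text \<open>Supplies the hypothesis \<open>zero\<close> of
  \<open>stratum_centred_uncorrelated\<close> for all strata: in \<open>s\<close> by the choice of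
  the mean, in the others because the function is supported in \<open>s\<close>.\<close>

lemma integral_stratum_centred:
  assumes f: "integrable M (\<lambda>\<omega>. f (W 1 \<omega>))"
  shows "(\<integral>\<omega>. stratum_centred s f (W 1 \<omega>) * indicator {t} (\<sigma> (W 1 \<omega>)) \<partial>M) = 0"
proof (cases "t = s")
  case True
  have "(\<integral>\<omega>. stratum_centred s f (W 1 \<omega>) * indicator {t} (\<sigma> (W 1 \<omega>)) \<partial>M) =
    (\<integral>\<omega>. f (W 1 \<omega>) * indicator {s} (\<sigma> (W 1 \<omega>)) - stratum_mean s f * indicator {s} (\<sigma> (W 1 \<omega>)) \<partial>M)"
    by (intro Bochner_Integration.integral_cong refl)
      (auto simp: True stratum_centred_def indicator_def)
  also have "\<dots> = stratum_mean s f * stratum_prob s - stratum_mean s f * stratum_prob s"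
    using integrable_times_stratum[OF f, of s] integrable_stratum_indicator[of s]
    by (subst Bochner_Integration.integral_diff)
      (simp_all only: stratum_integral_eq[OF f] stratum_prob_def integral_mult_right_zero integrable_mult_right)
  finally show ?thesis by simp
next
  case False
  then have eq: "stratum_centred s f w * indicator {t} (\<sigma> w) = 0" for w
    by (auto simp: stratum_centred_def indicator_def)
  show ?thesis unfolding eq by simp
qed

lemma stratum_mean_diff:
  assumes "integrable M (\<lambda>\<omega>. f (W 1 \<omega>))" "integrable M (\<lambda>\<omega>. g (W 1 \<omega>))"
  shows "stratum_mean s (\<lambda>w. f w - g w) = stratum_mean s f - stratum_mean s g"
  using integrable_times_stratum[OF assms(1), of s] integrable_times_stratum[OF assms(2), of s]
  by (simp add: stratum_mean_def left_diff_distrib diff_divide_distrib)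

lemma abs_stratum_mean_le:
  assumes f: "integrable M (\<lambda>\<omega>. f (W 1 \<omega>))"
  shows "\<bar>stratum_mean s f\<bar> * stratum_prob s \<le> (\<integral>\<omega>. \<bar>f (W 1 \<omega>)\<bar> * indicator {s} (\<sigma> (W 1 \<omega>)) \<partial>M)"
proof -
  have "\<bar>stratum_mean s f\<bar> * stratum_prob s = \<bar>stratum_mean s f * stratum_prob s\<bar>"
    using stratum_prob_nonneg[of s] by (simp add: abs_mult)
  also have "\<dots> = \<bar>\<integral>\<omega>. f (W 1 \<omega>) * indicator {s} (\<sigma> (W 1 \<omega>)) \<partial>M\<bar>"
    by (simp only: stratum_integral_eq[OF f])
  also have "\<dots> \<le> (\<integral>\<omega>. \<bar>f (W 1 \<omega>) * indicator {s} (\<sigma> (W 1 \<omega>))\<bar> \<partial>M)"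
    by (rule integral_abs_bound)
  finally show ?thesis by (simp add: abs_mult)
qed

text \<open>A stratum mean inherits the bound \<open>K\<close>, also as the default 0 of a null
  stratum; the triangle inequality doubles it.\<close>

lemma abs_stratum_centred_le:
  assumes f: "f \<in> borel_measurable N" and K: "\<And>w. \<bar>f w\<bar> \<le> K"
  shows "\<bar>stratum_centred s f w\<bar> \<le> 2 * K"
proof -
  have int: "integrable M (\<lambda>\<omega>. f (W 1 \<omega>))"
    using f K by (intro integrable_of_W_bounded) auto
  have K0: "K \<ge> 0" using K abs_ge_zero order.trans by blast
  have "\<bar>stratum_mean s f\<bar> \<le> K"
  proof (cases "stratum_prob s = 0")
    case False
    then have pos: "stratum_prob s > 0" using stratum_prob_nonneg[of s] by simp
    have "\<bar>stratum_mean s f\<bar> * stratum_prob s \<le> (\<integral>\<omega>. \<bar>f (W 1 \<omega>)\<bar> * indicator {s} (\<sigma> (W 1 \<omega>)) \<partial>M)"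
      by (rule abs_stratum_mean_le[OF int])
    also have "\<dots> \<le> (\<integral>\<omega>. K * indicator {s} (\<sigma> (W 1 \<omega>)) \<partial>M)"
      using integrable_times_stratum[OF integrable_abs[OF int], of s] integrable_stratum_indicator[of s] K
      by (intro integral_mono) (auto intro!: mult_right_mono)
    also have "\<dots> = K * stratum_prob s" by (simp add: stratum_prob_def)
    finally show ?thesis using pos by simp
  qed (simp add: stratum_mean_def K0)
  then have "\<bar>f w - stratum_mean s f\<bar> \<le> 2 * K"
    using K[of w] by linarith
  then show ?thesis using K0 by (auto simp: stratum_centred_def indicator_def)
qed

text \<open>Centring is bounded on L1 with constant 2, one share for the function and one for its
  mean. This controls the truncation tail.\<close>

lemma integral_abs_stratum_centred_le:
  assumes f: "integrable M (\<lambda>\<omega>. f (W 1 \<omega>))"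
  shows "(\<integral>\<omega>. \<bar>stratum_centred s f (W 1 \<omega>)\<bar> \<partial>M) \<le> 2 * (\<integral>\<omega>. \<bar>f (W 1 \<omega>)\<bar> \<partial>M)"
proof -
  note i1 = integrable_abs[OF f]
  note i2 = integrable_times_stratum[OF i1, of s]
  note i3 = integrable_stratum_indicator[of s]
  have le: "(\<integral>\<omega>. \<bar>f (W 1 \<omega>)\<bar> * indicator {s} (\<sigma> (W 1 \<omega>)) \<partial>M) \<le> (\<integral>\<omega>. \<bar>f (W 1 \<omega>)\<bar> \<partial>M)"
    using i1 i2 by (intro integral_mono) (auto simp: indicator_def)
  have "(\<integral>\<omega>. \<bar>stratum_centred s f (W 1 \<omega>)\<bar> \<partial>M) \<le>
    (\<integral>\<omega>. \<bar>f (W 1 \<omega>)\<bar> * indicator {s} (\<sigma> (W 1 \<omega>)) + \<bar>stratum_mean s f\<bar> * indicator {s} (\<sigma> (W 1 \<omega>)) \<partial>M)"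
    using i2 i3 integrable_stratum_centred[OF f, of s]
    by (intro integral_mono) (auto simp: stratum_centred_def indicator_def)
  also have "\<dots> = (\<integral>\<omega>. \<bar>f (W 1 \<omega>)\<bar> * indicator {s} (\<sigma> (W 1 \<omega>)) \<partial>M) + \<bar>stratum_mean s f\<bar> * stratum_prob s"
    using i2 i3 unfolding stratum_prob_def
    by (subst Bochner_Integration.integral_add) (simp_all only: integrable_mult_right integral_mult_right_zero)
  finally show ?thesis using abs_stratum_mean_le[OF f, of s] le by linarith
qed

lemma integrable_assigned_centred:
  assumes i: "i \<in> {1..n}" and f: "f \<in> borel_measurable N" "integrable M (\<lambda>\<omega>. f (W 1 \<omega>))"
    and B[measurable]: "B \<in> sets borel"
  shows "integrable M (\<lambda>\<omega>. indicator B (D n i \<omega>) * stratum_centred s f (W i \<omega>))"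
proof (rule Bochner_Integration.integrable_bound)
  show "integrable M (\<lambda>\<omega>. stratum_centred s f (W i \<omega>))"
    using integrable_stratum_centred[OF f(2)] integrable_W_iff[of i "stratum_centred s f"] i f(1)
    by simp
  then show "(\<lambda>\<omega>. indicator B (D n i \<omega>) * stratum_centred s f (W i \<omega>)) \<in> borel_measurable M"
    using measurable_D[OF i] by auto
qed (auto simp: indicator_def)

text \<open>The order of choices matters: first \<open>K\<close>, which makes the tail small for all
  n at once, and only then n, since the L2 bound grows with \<open>K\<close>.\<close>

lemma centred_mean_L1:
  assumes f[measurable]: "f \<in> borel_measurable N" and int: "integrable M (\<lambda>\<omega>. f (W 1 \<omega>))"
    and B[measurable]: "B \<in> sets borel"
  shows "(\<lambda>n. \<integral>\<omega>. \<bar>1 / real n * (\<Sum>i=1..n. indicator B (D n i \<omega>) * stratum_centred s f (W i \<omega>))\<bar> \<partial>M)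
    \<longlonglongrightarrow> 0"
proof (rule LIMSEQ_I)
  fix r :: real assume r: "r > 0"
  define A where "A g n \<omega> = 1 / real n * (\<Sum>i=1..n. indicator B (D n i \<omega>) * stratum_centred s g (W i \<omega>))"
    for g n \<omega>
  (* Truncation: the bounded part is controlled in L2, the tail uniformly in n in L1. *)
  define fK where "fK K w = f w * indicator {-K..K} (f w)" for K :: real and w
  have fKm[measurable]: "fK K \<in> borel_measurable N" for K unfolding fK_def by measurable
  have fK_bound: "\<bar>fK (real K) w\<bar> \<le> real K" for K w by (auto simp: fK_def indicator_def)
  have fK_int: "integrable M (\<lambda>\<omega>. fK (real K) (W 1 \<omega>))" for K
    using fK_bound by (intro integrable_of_W_bounded) auto
  have "(\<lambda>K. \<integral>\<omega>. \<bar>f (W 1 \<omega>) - fK (real K) (W 1 \<omega>)\<bar> \<partial>M) \<longlonglongrightarrow> (\<integral>\<omega>. 0 \<partial>M)"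
  proof (rule integral_dominated_convergence[where w = "\<lambda>\<omega>. \<bar>f (W 1 \<omega>)\<bar>"])
    show "AE \<omega> in M. (\<lambda>K. \<bar>f (W 1 \<omega>) - fK (real K) (W 1 \<omega>)\<bar>) \<longlonglongrightarrow> 0"
    proof (rule AE_I2, rule tendsto_eventually)
      fix \<omega> assume "\<omega> \<in> space M"
      obtain K0 :: nat where "\<bar>f (W 1 \<omega>)\<bar> \<le> real K0" using real_arch_simple by blast
      then show "\<forall>\<^sub>F K in sequentially. \<bar>f (W 1 \<omega>) - fK (real K) (W 1 \<omega>)\<bar> = 0"
        by (intro eventually_sequentiallyI[of K0]) (auto simp: fK_def indicator_def)
    qed
    show "integrable M (\<lambda>\<omega>. \<bar>f (W 1 \<omega>)\<bar>)" using int by simp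
  qed (auto simp: fK_def indicator_def)
  \<comment> \<open>A quarter of \<open>r\<close>, since centring may double the tail, which is to
    stay within half of \<open>r\<close>.\<close>
  then have "\<forall>\<^sub>F K in sequentially. (\<integral>\<omega>. \<bar>f (W 1 \<omega>) - fK (real K) (W 1 \<omega>)\<bar> \<partial>M) < r / 4"
    using r by (intro order_tendstoD(2)[where y = 0]) auto
  then obtain K where K: "(\<integral>\<omega>. \<bar>f (W 1 \<omega>) - fK (real K) (W 1 \<omega>)\<bar> \<partial>M) < r / 4"
    by (auto simp: eventually_sequentially)
  define g where "g = fK (real K)"
  define h where "h w = f w - g w" for w
  have gm[measurable]: "g \<in> borel_measurable N" and hm[measurable]: "h \<in> borel_measurable N"
    unfolding g_def h_def by measurable
  have g_int: "integrable M (\<lambda>\<omega>. g (W 1 \<omega>))" using fK_int by (simp add: g_def)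
  have h_int: "integrable M (\<lambda>\<omega>. h (W 1 \<omega>))" using int g_int by (simp add: h_def)
  have A_int: "integrable M (A u n)" if "u \<in> borel_measurable N" "integrable M (\<lambda>\<omega>. u (W 1 \<omega>))" for u n
    unfolding A_def using that
    by (intro integrable_mult_right Bochner_Integration.integrable_sum integrable_assigned_centred B)
  \<comment> \<open>\<open>g\<close> and \<open>h\<close> are centred separately because truncation
    shifts the stratum mean; by linearity of the mean the corrections add up.\<close>
  have split: "A f n \<omega> = A g n \<omega> + A h n \<omega>" for n \<omega>
  proof -
    have "stratum_centred s f w = stratum_centred s g w + stratum_centred s h w" for w
    proof -
      have "stratum_mean s h = stratum_mean s f - stratum_mean s g"
        unfolding h_def[abs_def] by (rule stratum_mean_diff[OF int g_int])
      then show ?thesis by (simp only: stratum_centred_def h_def) (simp add: algebra_simps)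
    qed
    then show ?thesis by (simp add: A_def sum.distrib ring_distribs)
  qed
  \<comment> \<open>The triangle inequality drops the assignment, and equal laws reduce the average
    to one unit, so the bound does not depend on n.\<close>
  have A_h: "(\<integral>\<omega>. \<bar>A h n \<omega>\<bar> \<partial>M) \<le> r / 2" for n
  proof -
    have h_abs_int: "integrable M (\<lambda>\<omega>. \<bar>stratum_centred s h (W i \<omega>)\<bar>)" if "i \<in> {1..n}" for i
      using integrable_stratum_centred[OF h_int] integrable_W_iff[of i "stratum_centred s h"] that
      by (intro integrable_abs) simp
    have h_abs_eq: "(\<integral>\<omega>. \<bar>stratum_centred s h (W i \<omega>)\<bar> \<partial>M) = (\<integral>\<omega>. \<bar>stratum_centred s h (W 1 \<omega>)\<bar> \<partial>M)"
      if "i \<in> {1..n}" for i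
      using that by (intro integral_W[of i "\<lambda>w. \<bar>stratum_centred s h w\<bar>"]) auto
    have "(\<integral>\<omega>. \<bar>A h n \<omega>\<bar> \<partial>M) \<le> (\<integral>\<omega>. 1 / real n * (\<Sum>i=1..n. \<bar>stratum_centred s h (W i \<omega>)\<bar>) \<partial>M)"
    proof (rule integral_mono)
      show "integrable M (\<lambda>\<omega>. \<bar>A h n \<omega>\<bar>)" using A_int[OF hm h_int] by simp
      show "integrable M (\<lambda>\<omega>. 1 / real n * (\<Sum>i=1..n. \<bar>stratum_centred s h (W i \<omega>)\<bar>))"
        by (intro integrable_mult_right Bochner_Integration.integrable_sum h_abs_int)
      fix \<omega>
      have "\<bar>\<Sum>i=1..n. indicator B (D n i \<omega>) * stratum_centred s h (W i \<omega>)\<bar>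
        \<le> (\<Sum>i=1..n. \<bar>indicator B (D n i \<omega>) * stratum_centred s h (W i \<omega>)\<bar>)"
        by (rule sum_abs)
      also have "\<dots> \<le> (\<Sum>i=1..n. \<bar>stratum_centred s h (W i \<omega>)\<bar>)"
        by (intro sum_mono) (auto simp: indicator_def)
      finally show "\<bar>A h n \<omega>\<bar> \<le> 1 / real n * (\<Sum>i=1..n. \<bar>stratum_centred s h (W i \<omega>)\<bar>)"
        by (simp add: A_def abs_mult divide_right_mono)
    qed
    also have "\<dots> = 1 / real n * (\<Sum>i=1..n. \<integral>\<omega>. \<bar>stratum_centred s h (W i \<omega>)\<bar> \<partial>M)"
      by (simp only: integral_mult_right_zero Bochner_Integration.integral_sum h_abs_int)
    also have "\<dots> = 1 / real n * (\<Sum>i=1..n. \<integral>\<omega>. \<bar>stratum_centred s h (W 1 \<omega>)\<bar> \<partial>M)"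
      by (intro arg_cong2[where f = "(*)"] refl sum.cong h_abs_eq)
    \<comment> \<open>An inequality rather than an equation, because of n = 0.\<close>
    also have "\<dots> \<le> (\<integral>\<omega>. \<bar>stratum_centred s h (W 1 \<omega>)\<bar> \<partial>M)"
      by simp
    also have "\<dots> \<le> 2 * (\<integral>\<omega>. \<bar>h (W 1 \<omega>)\<bar> \<partial>M)"
      by (rule integral_abs_stratum_centred_le[OF h_int])
    finally show ?thesis using K by (simp add: h_def g_def)
  qed
  have A_g: "(\<integral>\<omega>. \<bar>A g n \<omega>\<bar> \<partial>M) \<le> 2 * real K / sqrt (real n)" for n
    unfolding A_def
  proof (rule expectation_abs_mean_uncorrelated)
    have g_le: "\<bar>stratum_centred s g w\<bar> \<le> 2 * real K" for w
      using fK_bound by (intro abs_stratum_centred_le) (auto simp: g_def)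
    show "(\<lambda>\<omega>. indicator B (D n i \<omega>) * stratum_centred s g (W i \<omega>)) \<in> borel_measurable M"
      if "i \<in> {1..n}" for i using integrable_assigned_centred[OF that gm g_int B] by simp
    show "\<bar>indicator B (D n i \<omega>) * stratum_centred s g (W i \<omega>)\<bar> \<le> 2 * real K" for i \<omega>
      using g_le by (auto simp: indicator_def)
    show "(\<integral>\<omega>. (indicator B (D n i \<omega>) * stratum_centred s g (W i \<omega>)) *
        (indicator B (D n j \<omega>) * stratum_centred s g (W j \<omega>)) \<partial>M) = 0"
      if "i \<in> {1..n}" "j \<in> {1..n}" "i \<noteq> j" for i j
      using that g_le integral_stratum_centred[OF g_int]
      by (intro stratum_centred_uncorrelated[where K = "2 * real K"]) auto
  qed simp
  have "(\<lambda>n. 2 * real K / sqrt (real n)) \<longlonglongrightarrow> 0"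
    by (intro tendsto_divide_0[OF tendsto_const] filterlim_at_top_imp_at_infinity
        filterlim_compose[OF sqrt_at_top filterlim_real_sequentially])
  then have "\<forall>\<^sub>F n in sequentially. 2 * real K / sqrt (real n) < r / 2"
    using r by (intro order_tendstoD(2)[where y = 0]) auto
  then obtain n0 where n0: "\<And>n. n \<ge> n0 \<Longrightarrow> 2 * real K / sqrt (real n) < r / 2"
    by (auto simp: eventually_sequentially)
  show "\<exists>n0. \<forall>n\<ge>n0. norm ((\<integral>\<omega>. \<bar>1 / real n * (\<Sum>i=1..n. indicator B (D n i \<omega>) * stratum_centred s f (W i \<omega>))\<bar> \<partial>M) - 0) < r"
    unfolding A_def[symmetric]
  proof (intro exI[of _ n0] allI impI)
    fix n assume "n0 \<le> n"
    have "(\<integral>\<omega>. \<bar>A f n \<omega>\<bar> \<partial>M) \<le> (\<integral>\<omega>. \<bar>A g n \<omega>\<bar> + \<bar>A h n \<omega>\<bar> \<partial>M)"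
      using A_int[OF gm g_int] A_int[OF hm h_int] A_int[OF f int]
      by (intro integral_mono) (auto simp: split)
    also have "\<dots> = (\<integral>\<omega>. \<bar>A g n \<omega>\<bar> \<partial>M) + (\<integral>\<omega>. \<bar>A h n \<omega>\<bar> \<partial>M)"
      using A_int[OF gm g_int] A_int[OF hm h_int] by simp
    also have "\<dots> < r" using A_g[of n] A_h[of n] n0[OF \<open>n0 \<le> n\<close>] by linarith
    finally show "norm ((\<integral>\<omega>. \<bar>A f n \<omega>\<bar> \<partial>M) - 0) < r" by simp
  qed
qed

text \<open>Within the stratum, \<open>f\<close> is its deviation, negligible by
  \<open>centred_mean_L1\<close>, plus its mean, which multiplies the share of units in the cell.
  The factor \<open>p\<close> is left open so that both arms are covered.\<close>

lemma cell_mean_tendsto: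
  assumes f[measurable]: "f \<in> borel_measurable N" and int: "integrable M (\<lambda>\<omega>. f (W 1 \<omega>))"
    and B[measurable]: "B \<in> sets borel"
    and share: "tendsto_in_prob M
      (\<lambda>n \<omega>. 1 / real n * (\<Sum>i=1..n. indicator B (D n i \<omega>) * indicator {s} (\<sigma> (W i \<omega>)))) (p * stratum_prob s)"
  shows "tendsto_in_prob M
    (\<lambda>n \<omega>. 1 / real n * (\<Sum>i=1..n. f (W i \<omega>) * indicator B (D n i \<omega>) * indicator {s} (\<sigma> (W i \<omega>))))
    (p * (\<integral>\<omega>. f (W 1 \<omega>) * indicator {s} (\<sigma> (W 1 \<omega>)) \<partial>M))"
proof -
  let ?A = "\<lambda>n \<omega>. 1 / real n * (\<Sum>i=1..n. indicator B (D n i \<omega>) * stratum_centred s f (W i \<omega>))"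
  have "tendsto_in_prob M ?A 0"
  proof (rule tendsto_in_prob_L1[OF _ centred_mean_L1[OF f int B]])
    show "integrable M (?A n)" for n
      by (intro integrable_mult_right Bochner_Integration.integrable_sum
          integrable_assigned_centred[OF _ f int B])
  qed
  from tendsto_in_prob_add[OF this tendsto_in_prob_mult[OF share tendsto_in_prob_const[of M "stratum_mean s f"]]]
  have "tendsto_in_prob M (\<lambda>n \<omega>. ?A n \<omega> + 1 / real n * (\<Sum>i=1..n. indicator B (D n i \<omega>) *
      indicator {s} (\<sigma> (W i \<omega>))) * stratum_mean s f) (p * (stratum_mean s f * stratum_prob s))"
    by (simp add: mult_ac)
  also have "(\<lambda>n \<omega>. ?A n \<omega> + 1 / real n * (\<Sum>i=1..n. indicator B (D n i \<omega>) *
      indicator {s} (\<sigma> (W i \<omega>))) * stratum_mean s f) =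
    (\<lambda>n \<omega>. 1 / real n * (\<Sum>i=1..n. f (W i \<omega>) * indicator B (D n i \<omega>) * indicator {s} (\<sigma> (W i \<omega>))))"
    unfolding mult.assoc distrib_left[symmetric] sum_distrib_right sum.distrib[symmetric]
    by (intro ext, rule arg_cong2[where f = "(*)"], rule refl, rule sum.cong, rule refl)
      (simp add: stratum_centred_def algebra_simps)
  finally show ?thesis by (simp only: stratum_integral_eq[OF int])
qed

text \<open>The ordinary weak law for the labels: uncorrelatedness comes from plain independence,
  and the L2 bound is reused with constant 1.\<close>

lemma stratum_share_tendsto:
  "tendsto_in_prob M (\<lambda>n \<omega>. 1 / real n * (\<Sum>i=1..n. indicator {s} (\<sigma> (W i \<omega>)))) (stratum_prob s)"
proof -
  let ?I = "\<lambda>w. indicator {s} (\<sigma> w) - stratum_prob s :: real"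
  let ?A = "\<lambda>n \<omega>. 1 / real n * (\<Sum>i=1..n. ?I (W i \<omega>))"
  have Im[measurable]: "?I \<in> borel_measurable N" by measurable
  have "stratum_prob s \<le> (\<integral>\<omega>. 1 \<partial>M)"
    unfolding stratum_prob_def using integrable_stratum_indicator[of s]
    by (intro integral_mono) (auto simp: indicator_def)
  then have I_le: "\<bar>?I w\<bar> \<le> 1" for w
    using stratum_prob_nonneg[of s] by (auto simp: indicator_def prob_space)
  have I_int: "integrable M (\<lambda>\<omega>. ?I (W i \<omega>))" if "i \<ge> 1" for i
    using I_le that by (intro integrable_of_W_bounded[OF _ Im]) auto
  have I_0: "(\<integral>\<omega>. ?I (W i \<omega>) \<partial>M) = 0" if "i \<ge> 1" for i
    using integral_W[OF that Im] integrable_stratum_indicator[of s] by (simp add: stratum_prob_def prob_space)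
  have "tendsto_in_prob M ?A 0"
  proof (rule tendsto_in_prob_L1)
    show "integrable M (?A n)" for n
      using I_int by (intro integrable_mult_right Bochner_Integration.integrable_sum) auto
    have le: "(\<integral>\<omega>. \<bar>?A n \<omega>\<bar> \<partial>M) \<le> 1 / sqrt (real n)" for n
    proof (rule expectation_abs_mean_uncorrelated)
      fix i j assume ij: "i \<in> {1..n}" "j \<in> {1..n}" "i \<noteq> j"
      have "indep_vars (\<lambda>_. borel) (\<lambda>i \<omega>. ?I (W i \<omega>)) {i, j}"
        using ij by (intro indep_vars_compose2[OF indep_vars_subset[OF indep]] Im) auto
      then have "(\<integral>\<omega>. (\<Prod>k\<in>{i, j}. ?I (W k \<omega>)) \<partial>M) = (\<Prod>k\<in>{i, j}. \<integral>\<omega>. ?I (W k \<omega>) \<partial>M)"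
        using ij I_int by (intro indep_vars_lebesgue_integral) auto
      then show "(\<integral>\<omega>. ?I (W i \<omega>) * ?I (W j \<omega>) \<partial>M) = 0"
        using ij I_0[of i] by simp
    qed (use I_le measurable_of_W[OF _ Im] in auto)
    show "(\<lambda>n. \<integral>\<omega>. \<bar>?A n \<omega>\<bar> \<partial>M) \<longlonglongrightarrow> 0"
    proof (rule tendsto_sandwich[OF always_eventually always_eventually tendsto_const])
      show "(\<lambda>n. 1 / sqrt (real n)) \<longlonglongrightarrow> 0"
        by (intro tendsto_divide_0[OF tendsto_const] filterlim_at_top_imp_at_infinity
            filterlim_compose[OF sqrt_at_top filterlim_real_sequentially])
    qed (use le in auto)
  qed
  have lim: "tendsto_in_prob M (\<lambda>n \<omega>. ?A n \<omega> + stratum_prob s) (stratum_prob s)"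
    using tendsto_in_prob_add[OF \<open>tendsto_in_prob M ?A 0\<close> tendsto_in_prob_const[of M "stratum_prob s"]] by simp
  \<comment> \<open>For n = 0 the left side is \<open>stratum_prob s\<close> and the right side 0,
    hence the passage through \<open>tendsto_in_prob_eventually\<close>.\<close>
  have eq: "?A n \<omega> + stratum_prob s = 1 / real n * (\<Sum>i=1..n. indicator {s} (\<sigma> (W i \<omega>)))" if "n > 0" for n \<omega>
    using that by (simp only: sum_subtractf) (simp add: field_simps)
  show ?thesis
  proof (rule tendsto_in_prob_eventually[OF lim])
    show "\<forall>\<^sub>F n in sequentially. \<forall>\<omega>. ?A n \<omega> + stratum_prob s = 1 / real n * (\<Sum>i=1..n. indicator {s} (\<sigma> (W i \<omega>)))"
      using eq by (intro eventually_sequentiallyI[of 1]) auto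
    show "(\<lambda>\<omega>. 1 / real n * (\<Sum>i=1..n. indicator {s} (\<sigma> (W i \<omega>)))) \<in> borel_measurable M" for n
      using measurable_of_W[OF _ measurable_stratum_indicator]
      by (intro borel_measurable_times borel_measurable_const borel_measurable_sum) auto
  qed
qed

end

section \<open>The two estimators\<close>

text \<open>A binary \<open>r\<close> is the indicator of the conditioning event, and the uniform
  measure on that event has density \<open>r\<close> divided by its mean.\<close>

lemma (in prob_space) cond_expect_event_binary:
  fixes r y :: "'a \<Rightarrow> real"
  assumes r: "r \<in> borel_measurable M" and bin: "\<And>\<omega>. \<omega> \<in> space M \<Longrightarrow> r \<omega> \<in> {0, 1}"
    and pos: "(\<integral>\<omega>. r \<omega> \<partial>M) > 0" and y: "integrable M y"
  shows "cond_expect_event M y {\<omega> \<in> space M. r \<omega> = 1} = (\<integral>\<omega>. r \<omega> * y \<omega> \<partial>M) / (\<integral>\<omega>. r \<omega> \<partial>M)"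
proof -
  define A where "A = {\<omega> \<in> space M. r \<omega> = 1}"
  note [measurable] = r borel_measurable_integrable[OF y]
  have [measurable]: "A \<in> sets M" unfolding A_def by measurable
  have r_ind: "r \<omega> = indicator A \<omega>" if "\<omega> \<in> space M" for \<omega>
    using bin[OF that] that by (auto simp: A_def indicator_def)
  have "(\<integral>\<omega>. r \<omega> \<partial>M) = (\<integral>\<omega>. indicator A \<omega> \<partial>M)"
    by (rule Bochner_Integration.integral_cong[OF refl r_ind])
  then have pr: "(\<integral>\<omega>. r \<omega> \<partial>M) = prob A"
    by (simp add: Int_absorb2 sets.sets_into_space)
  have "uniform_measure M A = density M (\<lambda>\<omega>. ennreal (indicator A \<omega> / prob A))"
    unfolding uniform_measure_def
  proof (intro density_cong AE_I2)
    fix \<omega>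
    show "indicator A \<omega> / emeasure M A = ennreal (indicator A \<omega> / prob A)"
      using pos pr divide_ennreal[of 1 "prob A"] by (simp add: emeasure_eq_measure indicator_def)
  qed measurable
  then have "cond_expect_event M y A = (\<integral>\<omega>. indicator A \<omega> / prob A * y \<omega> \<partial>M)"
    unfolding cond_expect_event_def by (simp add: integral_density)
  also have "\<dots> = (\<integral>\<omega>. r \<omega> * y \<omega> / prob A \<partial>M)"
    by (intro Bochner_Integration.integral_cong refl) (simp add: r_ind)
  finally show ?thesis by (simp add: pr A_def)
qed

text \<open>For n = 0 the left side is 0 / 0 = 0, so the right side has to vanish too, as it does
  when \<open>x\<close> is an empty sum.\<close>

lemma ratio_rescale:
  fixes x y :: real
  assumes "n = 0 \<Longrightarrow> x = 0"
  shows "(1 / real n * x) / (1 / real n * y) = x / y"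
  using assms by (cases "n = 0") auto

text \<open>Responses are binary only along the sample \<open>W i \<omega>\<close>, because the
  value space \<open>N\<close> may allow any real response coordinate.\<close>

locale attrition_experiment = stratified_assignment M N W Str \<sigma> D
  for M :: "'w measure" and N :: "'a measure" and W Str and \<sigma> :: "'a \<Rightarrow> 's" and D +
  fixes \<nu> :: real and y1 y0 r1 r0 :: "'a \<Rightarrow> real"
  assumes measurable_outcomes[measurable]:
      "y1 \<in> borel_measurable N" "y0 \<in> borel_measurable N"
      "r1 \<in> borel_measurable N" "r0 \<in> borel_measurable N"
    and r1_bin: "\<And>i \<omega>. i \<ge> 1 \<Longrightarrow> \<omega> \<in> space M \<Longrightarrow> r1 (W i \<omega>) \<in> {0, 1}"
    and r0_bin: "\<And>i \<omega>. i \<ge> 1 \<Longrightarrow> \<omega> \<in> space M \<Longrightarrow> r0 (W i \<omega>) \<in> {0, 1}"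
    and y1_int: "integrable M (\<lambda>\<omega>. y1 (W 1 \<omega>))" and y0_int: "integrable M (\<lambda>\<omega>. y0 (W 1 \<omega>))"
    and r1_pos: "(\<integral>\<omega>. r1 (W 1 \<omega>) \<partial>M) > 0" and r0_pos: "(\<integral>\<omega>. r0 (W 1 \<omega>) \<partial>M) > 0"
    and nu: "0 < \<nu>" "\<nu> < 1"
    and D_bin: "\<And>n i \<omega>. i \<in> {1..n} \<Longrightarrow> \<omega> \<in> space M \<Longrightarrow> D n i \<omega> \<in> {0, 1}"
    and balance: "\<And>s. s \<in> Str \<Longrightarrow> tendsto_in_prob M
          (\<lambda>n \<omega>. (1 / real n) * (\<Sum>i=1..n. (D n i \<omega> - \<nu>) * indicator {s} (\<sigma> (W i \<omega>)))) 0"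
begin

section \<open>Limits of the cell means, and the difference in means\<close>

abbreviation stratum_integral :: "('a \<Rightarrow> real) \<Rightarrow> 's \<Rightarrow> real" where
  "stratum_integral f t \<equiv> \<integral>\<omega>. f (W 1 \<omega>) * indicator {t} (\<sigma> (W 1 \<omega>)) \<partial>M"

text \<open>The arm enters as \<open>indicator {d}\<close> instead of \<open>D\<close> or
  \<open>1 - D\<close>, so that \<open>cell_mean_tendsto\<close> applies to both arms, with a
  singleton for \<open>B\<close>.\<close>

definition cell_mean :: "real \<Rightarrow> ('a \<Rightarrow> real) \<Rightarrow> 's \<Rightarrow> nat \<Rightarrow> 'w \<Rightarrow> real" where
  "cell_mean d f t n \<omega> =
     1 / real n * (\<Sum>i=1..n. f (W i \<omega>) * indicator {d} (D n i \<omega>) * indicator {t} (\<sigma> (W i \<omega>)))"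

text \<open>Write \<open>D\<close> as \<open>D - \<nu>\<close> plus \<open>\<nu>\<close>: the first
  part is the balance condition, the second gives \<open>\<nu>\<close> times the stratum
  share.\<close>

lemma treated_share_tendsto:
  assumes "s \<in> Str"
  shows "tendsto_in_prob M
    (\<lambda>n \<omega>. 1 / real n * (\<Sum>i=1..n. indicator {1} (D n i \<omega>) * indicator {s} (\<sigma> (W i \<omega>)))) (\<nu> * stratum_prob s)"
proof -
  let ?share = "\<lambda>n \<omega>. 1 / real n * (\<Sum>i=1..n. indicator {s} (\<sigma> (W i \<omega>)))"
  have "tendsto_in_prob M (\<lambda>n \<omega>. (1 / real n) * (\<Sum>i=1..n. (D n i \<omega> - \<nu>) * indicator {s} (\<sigma> (W i \<omega>)))
      + \<nu> * ?share n \<omega>) (0 + \<nu> * stratum_prob s)"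
    by (intro tendsto_in_prob_add balance[OF assms] tendsto_in_prob_mult tendsto_in_prob_const
        stratum_share_tendsto)
  moreover have "(1 / real n) * (\<Sum>i=1..n. (D n i \<omega> - \<nu>) * indicator {s} (\<sigma> (W i \<omega>))) + \<nu> * ?share n \<omega>
      = 1 / real n * (\<Sum>i=1..n. indicator {1} (D n i \<omega>) * indicator {s} (\<sigma> (W i \<omega>)))"
    if \<omega>: "\<omega> \<in> space M" for n \<omega>
  proof -
    have "(1 / real n) * (\<Sum>i=1..n. (D n i \<omega> - \<nu>) * indicator {s} (\<sigma> (W i \<omega>))) + \<nu> * ?share n \<omega>
      = 1 / real n * (\<Sum>i=1..n. (D n i \<omega> - \<nu>) * indicator {s} (\<sigma> (W i \<omega>)) + \<nu> * indicator {s} (\<sigma> (W i \<omega>)))"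
      by (simp only: sum.distrib sum_distrib_left[symmetric]) algebra
    also have "\<dots> = 1 / real n * (\<Sum>i=1..n. indicator {1} (D n i \<omega>) * indicator {s} (\<sigma> (W i \<omega>)))"
      using D_bin[OF _ \<omega>] by (intro arg_cong2[where f = "(*)"] sum.cong refl)
        (force simp: algebra_simps indicator_def)
    finally show ?thesis .
  qed
  ultimately show ?thesis by (subst (asm) tendsto_in_prob_cong) auto
qed

lemma control_share_tendsto:
  assumes "s \<in> Str"
  shows "tendsto_in_prob M
    (\<lambda>n \<omega>. 1 / real n * (\<Sum>i=1..n. indicator {0} (D n i \<omega>) * indicator {s} (\<sigma> (W i \<omega>))))
    ((1 - \<nu>) * stratum_prob s)"
proof -
  have "tendsto_in_prob M (\<lambda>n \<omega>. 1 / real n * (\<Sum>i=1..n. indicator {s} (\<sigma> (W i \<omega>)))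
      - 1 / real n * (\<Sum>i=1..n. indicator {1} (D n i \<omega>) * indicator {s} (\<sigma> (W i \<omega>))))
      (stratum_prob s - \<nu> * stratum_prob s)"
    by (intro tendsto_in_prob_diff treated_share_tendsto[OF assms] stratum_share_tendsto)
  moreover have "1 / real n * (\<Sum>i=1..n. indicator {s} (\<sigma> (W i \<omega>)))
      - 1 / real n * (\<Sum>i=1..n. indicator {1} (D n i \<omega>) * indicator {s} (\<sigma> (W i \<omega>)))
      = 1 / real n * (\<Sum>i=1..n. indicator {0} (D n i \<omega>) * indicator {s} (\<sigma> (W i \<omega>)))"
    if \<omega>: "\<omega> \<in> space M" for n \<omega>
    unfolding right_diff_distrib[symmetric] sum_subtractf[symmetric]
    using D_bin[OF _ \<omega>] by (intro arg_cong2[where f = "(*)"] sum.cong refl)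
      (force simp: indicator_def)
  ultimately show ?thesis
    by (subst (asm) tendsto_in_prob_cong) (auto simp: left_diff_distrib)
qed

lemma cell_mean_treated:
  assumes "f \<in> borel_measurable N" "integrable M (\<lambda>\<omega>. f (W 1 \<omega>))" "t \<in> Str"
  shows "tendsto_in_prob M (cell_mean 1 f t) (\<nu> * stratum_integral f t)"
  using cell_mean_tendsto[OF assms(1,2) _ treated_share_tendsto[OF assms(3)]]
  by (simp add: cell_mean_def[abs_def])

lemma cell_mean_control:
  assumes "f \<in> borel_measurable N" "integrable M (\<lambda>\<omega>. f (W 1 \<omega>))" "t \<in> Str"
  shows "tendsto_in_prob M (cell_mean 0 f t) ((1 - \<nu>) * stratum_integral f t)"
  using cell_mean_tendsto[OF assms(1,2) _ control_share_tendsto[OF assms(3)]]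
  by (simp add: cell_mean_def[abs_def])

lemma sum_stratum_integral:
  assumes "integrable M (\<lambda>\<omega>. f (W 1 \<omega>))"
  shows "(\<Sum>t\<in>Str. stratum_integral f t) = (\<integral>\<omega>. f (W 1 \<omega>) \<partial>M)"
proof (rule integral_split_finite_range[symmetric, OF finite_Str _ assms])
  fix t
  have "(\<lambda>\<omega>. indicator {t} (\<sigma> (W 1 \<omega>)) :: real) \<in> borel_measurable M"
    by (rule measurable_of_W[OF _ measurable_stratum_indicator]) simp
  from measurable_sets[OF this, of "{1}"]
  show "{\<omega> \<in> space M. \<sigma> (W 1 \<omega>) = t} \<in> events"
    by (rule back_subst[where P = "\<lambda>A. A \<in> events"]) (auto simp: indicator_def)
qed (use stratum_in_Str in auto)

lemma integrable_response:
  "integrable M (\<lambda>\<omega>. r1 (W 1 \<omega>))" "integrable M (\<lambda>\<omega>. r0 (W 1 \<omega>))"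
proof -
  have [measurable]: "(\<lambda>\<omega>. r1 (W 1 \<omega>)) \<in> borel_measurable M" "(\<lambda>\<omega>. r0 (W 1 \<omega>)) \<in> borel_measurable M"
    by (rule measurable_of_W; simp add: measurable_outcomes)+
  show "integrable M (\<lambda>\<omega>. r1 (W 1 \<omega>))" "integrable M (\<lambda>\<omega>. r0 (W 1 \<omega>))"
    using r1_bin[of 1] r0_bin[of 1]
    by (force intro!: integrable_const_bound[where B = 1])+
qed

lemma integrable_observed:
  "integrable M (\<lambda>\<omega>. r1 (W 1 \<omega>) * y1 (W 1 \<omega>))" "integrable M (\<lambda>\<omega>. r0 (W 1 \<omega>) * y0 (W 1 \<omega>))"
proof -
  have [measurable]: "(\<lambda>\<omega>. f (W 1 \<omega>)) \<in> borel_measurable M" if "f \<in> {r1, r0, y1, y0}" for f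
    using that by (intro measurable_of_W) (auto simp: measurable_outcomes)
  show "integrable M (\<lambda>\<omega>. r1 (W 1 \<omega>) * y1 (W 1 \<omega>))"
    by (rule Bochner_Integration.integrable_bound[OF y1_int])
      (use r1_bin[of 1] in \<open>force intro!: borel_measurable_times AE_I2\<close>)+
  show "integrable M (\<lambda>\<omega>. r0 (W 1 \<omega>) * y0 (W 1 \<omega>))"
    by (rule Bochner_Integration.integrable_bound[OF y0_int])
      (use r0_bin[of 1] in \<open>force intro!: borel_measurable_times AE_I2\<close>)+
qed

lemmas cell_means_tendsto =
  cell_mean_treated[OF measurable_outcomes(3) integrable_response(1)]
  cell_mean_control[OF measurable_outcomes(4) integrable_response(2)]
  cell_mean_treated[OF borel_measurable_times[OF measurable_outcomes(3,1)] integrable_observed(1)]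
  cell_mean_control[OF borel_measurable_times[OF measurable_outcomes(4,2)] integrable_observed(2)]

abbreviation "sample_y n \<equiv> observed_outcome (\<lambda>i \<omega>. y1 (W i \<omega>)) (\<lambda>i \<omega>. y0 (W i \<omega>))
  (\<lambda>i \<omega>. r1 (W i \<omega>)) (\<lambda>i \<omega>. r0 (W i \<omega>)) (D n)"

abbreviation "sample_r n \<equiv> realized_response (\<lambda>i \<omega>. r1 (W i \<omega>)) (\<lambda>i \<omega>. r0 (W i \<omega>)) (D n)"

text \<open>In each arm the terms of the other arm vanish, and a binary response equals its own
  square, which absorbs the extra factor \<open>sample_r\<close> in the outcome products.\<close>

lemma sample_cells:
  assumes "i \<in> {1..n}" "\<omega> \<in> space M"
  shows "sample_r n i \<omega> * D n i \<omega> = r1 (W i \<omega>) * indicator {1} (D n i \<omega>)"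
    and "sample_r n i \<omega> * (1 - D n i \<omega>) = r0 (W i \<omega>) * indicator {0} (D n i \<omega>)"
    and "sample_y n i \<omega> * sample_r n i \<omega> * D n i \<omega> = r1 (W i \<omega>) * y1 (W i \<omega>) * indicator {1} (D n i \<omega>)"
    and "sample_y n i \<omega> * sample_r n i \<omega> * (1 - D n i \<omega>) =
      r0 (W i \<omega>) * y0 (W i \<omega>) * indicator {0} (D n i \<omega>)"
    and "sample_r n i \<omega> \<in> {0, 1}"
  using D_bin[OF assms] r1_bin[of i \<omega>] r0_bin[of i \<omega>] assms
  by (auto simp: realized_response_def observed_outcome_def)

lemma sum_cell_mean:
  assumes "\<omega> \<in> space M"
  shows "(\<Sum>t\<in>Str. cell_mean d f t n \<omega>) = 1 / real n * (\<Sum>i=1..n. f (W i \<omega>) * indicator {d} (D n i \<omega>))"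
  unfolding cell_mean_def sum_distrib_left[symmetric]
  by (subst sum_over_strata) (use finite_Str stratum_in_Str assms in auto)

text \<open>Every stratum has the same limiting treated proportion, so summing the cells over strata
  leaves unconditional means, and \<open>\<nu>\<close> and \<open>1 - \<nu>\<close> cancel within
  each ratio.\<close>

lemma diff_in_means_tendsto:
  "tendsto_in_prob M (\<lambda>n \<omega>. diff_in_means n (\<lambda>i. sample_y n i \<omega>) (\<lambda>i. sample_r n i \<omega>) (\<lambda>i. D n i \<omega>))
    (theta_obs M (\<lambda>\<omega>. y1 (W 1 \<omega>)) (\<lambda>\<omega>. y0 (W 1 \<omega>)) (\<lambda>\<omega>. r1 (W 1 \<omega>)) (\<lambda>\<omega>. r0 (W 1 \<omega>)))"
proof -
  let ?S = "\<lambda>d f n \<omega>. \<Sum>t\<in>Str. cell_mean d f t n \<omega>"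
  have lims: "tendsto_in_prob M (?S 1 r1) (\<Sum>t\<in>Str. \<nu> * stratum_integral r1 t)"
    "tendsto_in_prob M (?S 0 r0) (\<Sum>t\<in>Str. (1 - \<nu>) * stratum_integral r0 t)"
    "tendsto_in_prob M (?S 1 (\<lambda>w. r1 w * y1 w)) (\<Sum>t\<in>Str. \<nu> * stratum_integral (\<lambda>w. r1 w * y1 w) t)"
    "tendsto_in_prob M (?S 0 (\<lambda>w. r0 w * y0 w)) (\<Sum>t\<in>Str. (1 - \<nu>) * stratum_integral (\<lambda>w. r0 w * y0 w) t)"
    by (intro tendsto_in_prob_sum cell_means_tendsto; assumption)+
  note lims = lims[unfolded sum_distrib_left[symmetric] sum_stratum_integral[OF integrable_response(1)]
      sum_stratum_integral[OF integrable_response(2)]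
      sum_stratum_integral[of "\<lambda>w. r1 w * y1 w", OF integrable_observed(1)]
      sum_stratum_integral[of "\<lambda>w. r0 w * y0 w", OF integrable_observed(2)]]
  have "tendsto_in_prob M (\<lambda>n \<omega>. ?S 1 (\<lambda>w. r1 w * y1 w) n \<omega> / ?S 1 r1 n \<omega> - ?S 0 (\<lambda>w. r0 w * y0 w) n \<omega> / ?S 0 r0 n \<omega>)
    (\<nu> * (\<integral>\<omega>. r1 (W 1 \<omega>) * y1 (W 1 \<omega>) \<partial>M) / (\<nu> * (\<integral>\<omega>. r1 (W 1 \<omega>) \<partial>M)) -
     (1 - \<nu>) * (\<integral>\<omega>. r0 (W 1 \<omega>) * y0 (W 1 \<omega>) \<partial>M) / ((1 - \<nu>) * (\<integral>\<omega>. r0 (W 1 \<omega>) \<partial>M)))"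
    using nu r1_pos r0_pos by (intro tendsto_in_prob_diff tendsto_in_prob_divide lims) auto
  also have "(\<nu> * (\<integral>\<omega>. r1 (W 1 \<omega>) * y1 (W 1 \<omega>) \<partial>M) / (\<nu> * (\<integral>\<omega>. r1 (W 1 \<omega>) \<partial>M)) -
     (1 - \<nu>) * (\<integral>\<omega>. r0 (W 1 \<omega>) * y0 (W 1 \<omega>) \<partial>M) / ((1 - \<nu>) * (\<integral>\<omega>. r0 (W 1 \<omega>) \<partial>M))) =
    theta_obs M (\<lambda>\<omega>. y1 (W 1 \<omega>)) (\<lambda>\<omega>. y0 (W 1 \<omega>)) (\<lambda>\<omega>. r1 (W 1 \<omega>)) (\<lambda>\<omega>. r0 (W 1 \<omega>))"
    using nu by (simp add: theta_obs_def)
  finally show ?thesis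
  proof (rule tendsto_in_prob_cong[THEN iffD1, rotated])
    fix n \<omega> assume \<omega>: "\<omega> \<in> space M"
    show "?S 1 (\<lambda>w. r1 w * y1 w) n \<omega> / ?S 1 r1 n \<omega> - ?S 0 (\<lambda>w. r0 w * y0 w) n \<omega> / ?S 0 r0 n \<omega> =
      diff_in_means n (\<lambda>i. sample_y n i \<omega>) (\<lambda>i. sample_r n i \<omega>) (\<lambda>i. D n i \<omega>)"
      unfolding diff_in_means_def sum_cell_mean[OF \<omega>]
      by (subst (1 2) ratio_rescale) (simp_all only: sample_cells[OF _ \<omega>] cong: sum.cong, simp_all)
  qed
qed

text \<open>A nonnegative function with zero integral vanishes almost surely, and does so for every
  unit because the laws are equal. The cell mean is thus exactly 0 at each n and not merely in the
  limit, which is what a denominator calls for.\<close>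

lemma cell_mean_eq_0:
  assumes f: "f \<in> borel_measurable N" "integrable M (\<lambda>\<omega>. f (W 1 \<omega>))"
    and nonneg: "\<And>\<omega>. \<omega> \<in> space M \<Longrightarrow> f (W 1 \<omega>) \<ge> 0" and zero: "stratum_integral f t = 0"
  shows "AE \<omega> in M. cell_mean d f t n \<omega> = 0"
proof -
  let ?g = "\<lambda>w. f w * indicator {t} (\<sigma> w)"
  have gm: "(\<lambda>w. \<bar>?g w\<bar>) \<in> borel_measurable N"
    using f(1) by (intro borel_measurable_abs borel_measurable_times measurable_stratum_indicator)
  have g_int: "integrable M (\<lambda>\<omega>. \<bar>?g (W 1 \<omega>)\<bar>)"
    using integrable_times_stratum[OF f(2), of t] by (rule integrable_abs)
  have "AE \<omega> in M. ?g (W i \<omega>) = 0" if i: "i \<in> {1..n}" for i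
  proof -
    have "(\<integral>\<omega>. \<bar>?g (W i \<omega>)\<bar> \<partial>M) = (\<integral>\<omega>. \<bar>?g (W 1 \<omega>)\<bar> \<partial>M)"
      using i by (intro integral_W[OF _ gm]) auto
    also have "\<dots> = stratum_integral f t"
      using nonneg by (intro Bochner_Integration.integral_cong) (auto simp: indicator_def)
    finally have "(\<integral>\<omega>. \<bar>?g (W i \<omega>)\<bar> \<partial>M) = 0" using zero by simp
    moreover have "integrable M (\<lambda>\<omega>. \<bar>?g (W i \<omega>)\<bar>)"
      using integrable_W_iff[OF _ gm, of i] g_int i by simp
    ultimately show ?thesis
      by (subst (asm) integral_nonneg_eq_0_iff_AE) (auto elim!: eventually_mono)
  qed
  then have "AE \<omega> in M. \<forall>i\<in>{1..n}. ?g (W i \<omega>) = 0" by (intro AE_finite_allI) auto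
  then show ?thesis
  proof eventually_elim
    case (elim \<omega>)
    then have "(\<Sum>i=1..n. f (W i \<omega>) * indicator {d} (D n i \<omega>) * indicator {t} (\<sigma> (W i \<omega>))) = 0"
      by (intro sum.neutral) auto
    then show ?case unfolding cell_mean_def by (simp only: mult_zero_right)
  qed
qed

lemmas cell_mean_response_eq_0 =
  cell_mean_eq_0[OF measurable_outcomes(3) integrable_response(1)]
  cell_mean_eq_0[OF measurable_outcomes(4) integrable_response(2)]

lemma response_nonneg:
  "\<omega> \<in> space M \<Longrightarrow> r1 (W 1 \<omega>) \<ge> 0" "\<omega> \<in> space M \<Longrightarrow> r0 (W 1 \<omega>) \<ge> 0"
  using r1_bin[of 1 \<omega>] r0_bin[of 1 \<omega>] by auto

lemma stratum_integral_response_nonneg: "stratum_integral r1 t \<ge> 0" "stratum_integral r0 t \<ge> 0"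
  using response_nonneg by (auto intro!: integral_nonneg_AE AE_I2)

lemma weighted_response_eq_0_iff:
  "\<nu> * stratum_integral r1 t + (1 - \<nu>) * stratum_integral r0 t = 0 \<longleftrightarrow>
    stratum_integral r1 t = 0 \<and> stratum_integral r0 t = 0"
  using nu stratum_integral_response_nonneg[of t] by (subst add_nonneg_eq_0_iff) auto

text \<open>If the limiting denominator is 0, both response integrals are 0, the sample denominator
  is 0 almost surely, and ratio and limit are both 0 whatever \<open>Q\<close> does.\<close>

lemma stratum_ratio_tendsto:
  assumes t: "t \<in> Str" and Q: "tendsto_in_prob M Q q"
  shows "tendsto_in_prob M (\<lambda>n \<omega>. Q n \<omega> / (cell_mean 1 r1 t n \<omega> + cell_mean 0 r0 t n \<omega>))
    (q / (\<nu> * stratum_integral r1 t + (1 - \<nu>) * stratum_integral r0 t))"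
proof (cases "\<nu> * stratum_integral r1 t + (1 - \<nu>) * stratum_integral r0 t = 0")
  case False
  then show ?thesis
    using t by (intro tendsto_in_prob_divide tendsto_in_prob_add Q cell_means_tendsto) auto
next
  case True
  then have zero: "stratum_integral r1 t = 0" "stratum_integral r0 t = 0"
    by (simp_all only: weighted_response_eq_0_iff)
  note [measurable] = tendsto_in_prob_measurable[OF Q]
    tendsto_in_prob_measurable[OF cell_means_tendsto(1)[OF t]]
    tendsto_in_prob_measurable[OF cell_means_tendsto(2)[OF t]]
  show ?thesis unfolding True
  proof (rule tendsto_in_prob_AE_cong)
    show "tendsto_in_prob M (\<lambda>n \<omega>. 0) (q / 0)" by (simp add: tendsto_in_prob_const)
    show "AE \<omega> in M. 0 = Q n \<omega> / (cell_mean 1 r1 t n \<omega> + cell_mean 0 r0 t n \<omega>)" for n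
    proof -
      have "AE \<omega> in M. cell_mean 1 r1 t n \<omega> = 0" "AE \<omega> in M. cell_mean 0 r0 t n \<omega> = 0"
        using cell_mean_response_eq_0 response_nonneg zero by blast+
      then show ?thesis by eventually_elim simp
    qed
  qed measurable
qed

lemma sfe_coef_cells:
  assumes \<omega>: "\<omega> \<in> space M"
  shows "sfe_coef Str n (\<lambda>i. sample_y n i \<omega>) (\<lambda>i. sample_r n i \<omega>) (\<lambda>i. D n i \<omega>) (\<lambda>i. \<sigma> (W i \<omega>)) =
    (\<Sum>t\<in>Str. (cell_mean 1 (\<lambda>w. r1 w * y1 w) t n \<omega> * cell_mean 0 r0 t n \<omega>
      - cell_mean 0 (\<lambda>w. r0 w * y0 w) t n \<omega> * cell_mean 1 r1 t n \<omega>) /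
      (cell_mean 1 r1 t n \<omega> + cell_mean 0 r0 t n \<omega>)) /
    (\<Sum>t\<in>Str. cell_mean 1 r1 t n \<omega> * cell_mean 0 r0 t n \<omega> /
      (cell_mean 1 r1 t n \<omega> + cell_mean 0 r0 t n \<omega>))"
proof -
  define c where "c d f t = (\<Sum>i=1..n. f (W i \<omega>) * indicator {d} (D n i \<omega>) * indicator {t} (\<sigma> (W i \<omega>)))"
    for d :: real and f :: "'a \<Rightarrow> real" and t
  have cm: "cell_mean d f t n \<omega> = 1 / real n * c d f t" for d f t
    by (simp only: cell_mean_def c_def)
  \<comment> \<open>Each summand has degree 1 in the cell sums: two factors 1/n above and one below
    leave one, which cancels between numerator and denominator of the coefficient.\<close>
  have scale: "(1 / real n * a * (1 / real n * b)) / (1 / real n * u + 1 / real n * v) = 1 / real n * (a * b / (u + v))"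
    for a b u v :: real
    by (cases "n = 0"; cases "u + v = 0") (auto simp: divide_simps distrib_left[symmetric])
  have str: "\<sigma> (W i \<omega>) \<in> Str" if "i \<in> {1..n}" for i
    using that stratum_in_Str[OF _ \<omega>] by simp
  have cells: "(\<Sum>i=1..n. sample_r n i \<omega> * D n i \<omega> * indicator {t} (\<sigma> (W i \<omega>))) = c 1 r1 t"
    "(\<Sum>i=1..n. sample_r n i \<omega> * (1 - D n i \<omega>) * indicator {t} (\<sigma> (W i \<omega>))) = c 0 r0 t"
    "(\<Sum>i=1..n. sample_y n i \<omega> * sample_r n i \<omega> * D n i \<omega> * indicator {t} (\<sigma> (W i \<omega>))) =
      c 1 (\<lambda>w. r1 w * y1 w) t"
    "(\<Sum>i=1..n. sample_y n i \<omega> * sample_r n i \<omega> * (1 - D n i \<omega>) * indicator {t} (\<sigma> (W i \<omega>))) =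
      c 0 (\<lambda>w. r0 w * y0 w) t" for t
    unfolding c_def by (intro sum.cong refl; simp only: sample_cells[OF _ \<omega>])+
  have "sfe_coef Str n (\<lambda>i. sample_y n i \<omega>) (\<lambda>i. sample_r n i \<omega>) (\<lambda>i. D n i \<omega>) (\<lambda>i. \<sigma> (W i \<omega>)) =
    (\<Sum>t\<in>Str. (c 1 (\<lambda>w. r1 w * y1 w) t * c 0 r0 t - c 0 (\<lambda>w. r0 w * y0 w) t * c 1 r1 t) / (c 1 r1 t + c 0 r0 t)) /
    (\<Sum>t\<in>Str. c 1 r1 t * c 0 r0 t / (c 1 r1 t + c 0 r0 t))"
    by (subst sfe_coef_eq[OF finite_Str str sample_cells(5)[OF _ \<omega>] D_bin[OF _ \<omega>]]) (simp_all only: cells)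
  also have "\<dots> = (1 / real n * (\<Sum>t\<in>Str. (c 1 (\<lambda>w. r1 w * y1 w) t * c 0 r0 t - c 0 (\<lambda>w. r0 w * y0 w) t * c 1 r1 t) / (c 1 r1 t + c 0 r0 t))) /
    (1 / real n * (\<Sum>t\<in>Str. c 1 r1 t * c 0 r0 t / (c 1 r1 t + c 0 r0 t)))"
    by (rule ratio_rescale[symmetric]) (simp add: c_def)
  finally show ?thesis
    unfolding cm diff_divide_distrib scale sum_distrib_left right_diff_distrib .
qed

text \<open>Each product pairs a treated cell with a control cell, so every summand above and below
  carries the factor \<open>\<nu> * (1 - \<nu>)\<close>, which cancels in the quotient.\<close>

lemma sfe_coef_tendsto:
  defines "a \<equiv> stratum_integral r1" and "b \<equiv> stratum_integral r0"
    and "u \<equiv> stratum_integral (\<lambda>w. r1 w * y1 w)" and "v \<equiv> stratum_integral (\<lambda>w. r0 w * y0 w)"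
  shows "tendsto_in_prob M
    (\<lambda>n \<omega>. sfe_coef Str n (\<lambda>i. sample_y n i \<omega>) (\<lambda>i. sample_r n i \<omega>) (\<lambda>i. D n i \<omega>) (\<lambda>i. \<sigma> (W i \<omega>)))
    ((\<Sum>t\<in>Str. (u t * b t - v t * a t) / (\<nu> * a t + (1 - \<nu>) * b t)) /
     (\<Sum>t\<in>Str. a t * b t / (\<nu> * a t + (1 - \<nu>) * b t)))"
proof -
  let ?m = "\<lambda>t n \<omega>. cell_mean 1 r1 t n \<omega> + cell_mean 0 r0 t n \<omega>"
  let ?A = "\<lambda>n \<omega>. \<Sum>t\<in>Str. (cell_mean 1 (\<lambda>w. r1 w * y1 w) t n \<omega> * cell_mean 0 r0 t n \<omega>
      - cell_mean 0 (\<lambda>w. r0 w * y0 w) t n \<omega> * cell_mean 1 r1 t n \<omega>) / ?m t n \<omega>"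
  let ?B = "\<lambda>n \<omega>. \<Sum>t\<in>Str. cell_mean 1 r1 t n \<omega> * cell_mean 0 r0 t n \<omega> / ?m t n \<omega>"
  define LA where "LA = (\<Sum>t\<in>Str. (u t * b t - v t * a t) / (\<nu> * a t + (1 - \<nu>) * b t))"
  define LB where "LB = (\<Sum>t\<in>Str. a t * b t / (\<nu> * a t + (1 - \<nu>) * b t))"
  have "tendsto_in_prob M ?A (\<Sum>t\<in>Str. (\<nu> * u t * ((1 - \<nu>) * b t) - (1 - \<nu>) * v t * (\<nu> * a t)) / (\<nu> * a t + (1 - \<nu>) * b t))"
    unfolding a_def b_def u_def v_def
    by (intro tendsto_in_prob_sum stratum_ratio_tendsto tendsto_in_prob_diff tendsto_in_prob_mult
        cell_means_tendsto; assumption)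
  also have "(\<Sum>t\<in>Str. (\<nu> * u t * ((1 - \<nu>) * b t) - (1 - \<nu>) * v t * (\<nu> * a t)) / (\<nu> * a t + (1 - \<nu>) * b t)) =
      \<nu> * (1 - \<nu>) * LA"
    unfolding LA_def sum_distrib_left
    by (intro sum.cong refl) (simp add: times_divide_eq_right[symmetric] algebra_simps)
  finally have A: "tendsto_in_prob M ?A (\<nu> * (1 - \<nu>) * LA)" .
  have "tendsto_in_prob M ?B (\<Sum>t\<in>Str. \<nu> * a t * ((1 - \<nu>) * b t) / (\<nu> * a t + (1 - \<nu>) * b t))"
    unfolding a_def b_def
    by (intro tendsto_in_prob_sum stratum_ratio_tendsto tendsto_in_prob_mult cell_means_tendsto; assumption)
  also have "(\<Sum>t\<in>Str. \<nu> * a t * ((1 - \<nu>) * b t) / (\<nu> * a t + (1 - \<nu>) * b t)) = \<nu> * (1 - \<nu>) * LB"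
    unfolding LB_def sum_distrib_left by (intro sum.cong refl) simp
  finally have B: "tendsto_in_prob M ?B (\<nu> * (1 - \<nu>) * LB)" .
  have "tendsto_in_prob M (\<lambda>n \<omega>. ?A n \<omega> / ?B n \<omega>) (\<nu> * (1 - \<nu>) * LA / (\<nu> * (1 - \<nu>) * LB))"
  proof (cases "LB = 0")
    case False
    then show ?thesis using nu by (intro tendsto_in_prob_divide A B) auto
  next
    case True
    (* The coefficient on D is not identified in the limit; almost surely it is not identified in
       any sample either, so both sides are the junk value 0. *)
    have nonneg: "a t \<ge> 0" "b t \<ge> 0" for t
      unfolding a_def b_def by (rule stratum_integral_response_nonneg)+
    have weight: "\<nu> * a t + (1 - \<nu>) * b t = 0 \<longleftrightarrow> a t = 0 \<and> b t = 0" for t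
      unfolding a_def b_def by (rule weighted_response_eq_0_iff)
    \<comment> \<open>Nonnegative terms sum to 0, so each is 0, and every stratum lacks responses in
      at least one arm.\<close>
    have terms: "a t * b t / (\<nu> * a t + (1 - \<nu>) * b t) = 0" if "t \<in> Str" for t
      using True that nu nonneg unfolding LB_def
      by (subst (asm) sum_nonneg_eq_0_iff) (auto simp: finite_Str)
    have "AE \<omega> in M. cell_mean 1 r1 t n \<omega> * cell_mean 0 r0 t n \<omega> = 0" if "t \<in> Str" for t n
    proof -
      from terms[OF that] have "a t = 0 \<or> b t = 0"
        unfolding divide_eq_0_iff mult_eq_0_iff weight by blast
      then show ?thesis
      proof
        assume "a t = 0"
        then have "AE \<omega> in M. cell_mean 1 r1 t n \<omega> = 0"
          unfolding a_def by (intro cell_mean_response_eq_0 response_nonneg)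
        then show ?thesis by eventually_elim simp
      next
        assume "b t = 0"
        then have "AE \<omega> in M. cell_mean 0 r0 t n \<omega> = 0"
          unfolding b_def by (intro cell_mean_response_eq_0 response_nonneg)
        then show ?thesis by eventually_elim simp
      qed
    qed
    then have zero: "AE \<omega> in M. \<forall>t\<in>Str. cell_mean 1 r1 t n \<omega> * cell_mean 0 r0 t n \<omega> = 0" for n
      by (intro AE_finite_allI finite_Str)
    show ?thesis
    proof (rule tendsto_in_prob_AE_cong)
      show "tendsto_in_prob M (\<lambda>n \<omega>. 0) (\<nu> * (1 - \<nu>) * LA / (\<nu> * (1 - \<nu>) * LB))"
        by (simp add: True tendsto_in_prob_const)
      show "AE \<omega> in M. 0 = ?A n \<omega> / ?B n \<omega>" for n
        using zero[of n]
      proof eventually_elim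
        case (elim \<omega>)
        then have "?B n \<omega> = 0" by (intro sum.neutral) simp
        then show ?case by simp
      qed
      show "(\<lambda>\<omega>. ?A n \<omega> / ?B n \<omega>) \<in> borel_measurable M" for n
        by (intro borel_measurable_divide tendsto_in_prob_measurable[OF A] tendsto_in_prob_measurable[OF B])
    qed
  qed
  then have "tendsto_in_prob M (\<lambda>n \<omega>. ?A n \<omega> / ?B n \<omega>) (LA / LB)" using nu by simp
  then show ?thesis unfolding LA_def LB_def
    by (rule tendsto_in_prob_cong[THEN iffD1, rotated]) (simp only: sfe_coef_cells)
qed

section \<open>The fixed effects estimand as a ratio of sums over strata\<close>

lemma cond_expect_stratum:
  assumes f: "integrable M (\<lambda>\<omega>. f (W 1 \<omega>))" and \<omega>: "\<omega> \<in> space M"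
    and pos: "stratum_prob (\<sigma> (W 1 \<omega>)) \<noteq> 0"
  shows "cond_expect M (count_space Str) (\<lambda>\<omega>. \<sigma> (W 1 \<omega>)) (\<lambda>\<omega>. f (W 1 \<omega>)) \<omega> = stratum_mean (\<sigma> (W 1 \<omega>)) f"
proof -
  let ?t = "\<sigma> (W 1 \<omega>)"
  have m: "(\<lambda>\<omega>. \<sigma> (W 1 \<omega>)) \<in> measurable M (count_space Str)"
    by (rule measurable_compose[OF measurable_W1(1) measurable_stratum])
  have "{\<omega>' \<in> space M. \<sigma> (W 1 \<omega>') = ?t} = (\<lambda>\<omega>. \<sigma> (W 1 \<omega>)) -` {?t} \<inter> space M" by auto
  also have "\<dots> \<in> events" using stratum_in_Str[OF _ \<omega>] by (intro measurable_sets[OF m]) auto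
  finally have ev: "{\<omega>' \<in> space M. \<sigma> (W 1 \<omega>') = ?t} \<in> events" .
  have "stratum_prob ?t = (\<integral>\<omega>'. indicator {\<omega>' \<in> space M. \<sigma> (W 1 \<omega>') = ?t} \<omega>' \<partial>M)"
    unfolding stratum_prob_def by (intro Bochner_Integration.integral_cong) (auto simp: indicator_def)
  then have p: "prob {\<omega>' \<in> space M. \<sigma> (W 1 \<omega>') = ?t} = stratum_prob ?t"
    using ev by (simp add: Int_absorb2)
  have "cond_expect M (count_space Str) (\<lambda>\<omega>. \<sigma> (W 1 \<omega>)) (\<lambda>\<omega>. f (W 1 \<omega>)) \<omega> * stratum_prob ?t =
    stratum_integral f ?t"
    using cond_expect_atom[OF m f \<omega>] stratum_in_Str[OF _ \<omega>] unfolding p by simp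
  then show ?thesis using pos by (simp add: stratum_mean_def field_simps)
qed

text \<open>There are finitely many strata, so the null ones together form a null event.\<close>

lemma AE_stratum_prob_nonzero: "AE \<omega> in M. stratum_prob (\<sigma> (W 1 \<omega>)) \<noteq> 0"
proof -
  have "AE \<omega> in M. stratum_prob t = 0 \<longrightarrow> \<sigma> (W 1 \<omega>) \<noteq> t" for t
  proof (cases "stratum_prob t = 0")
    case True
    then have "AE \<omega> in M. indicator {t} (\<sigma> (W 1 \<omega>)) = (0 :: real)"
      unfolding stratum_prob_def
      by (subst (asm) integral_nonneg_eq_0_iff_AE[OF integrable_stratum_indicator]) auto
    then show ?thesis by (auto elim!: eventually_mono simp: indicator_def)
  qed simp
  then have "AE \<omega> in M. \<forall>t\<in>Str. stratum_prob t = 0 \<longrightarrow> \<sigma> (W 1 \<omega>) \<noteq> t"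
    by (intro AE_finite_allI finite_Str)
  then show ?thesis using AE_space
    by eventually_elim (use stratum_in_Str[of 1] in auto)
qed

text \<open>Conditional expectations are pinned down only on strata of positive probability, so
  \<open>G\<close> is compared with \<open>g\<close> only there; the values of \<open>g\<close> at
  null strata have weight 0.\<close>

lemma integral_stratum_function:
  fixes g :: "'s \<Rightarrow> real"
  assumes G: "G \<in> borel_measurable M"
    and eq: "\<And>\<omega>. \<omega> \<in> space M \<Longrightarrow> stratum_prob (\<sigma> (W 1 \<omega>)) \<noteq> 0 \<Longrightarrow> G \<omega> = g (\<sigma> (W 1 \<omega>))"
  shows "(\<integral>\<omega>. G \<omega> \<partial>M) = (\<Sum>t\<in>Str. g t * stratum_prob t)"
proof -
  have ind: "(\<lambda>\<omega>. indicator {t} (\<sigma> (W 1 \<omega>)) :: real) \<in> borel_measurable M" for t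
    by (rule measurable_of_W[OF _ measurable_stratum_indicator]) simp
  have "(\<integral>\<omega>. G \<omega> \<partial>M) = (\<integral>\<omega>. (\<Sum>t\<in>Str. g t * indicator {t} (\<sigma> (W 1 \<omega>))) \<partial>M)"
  proof (rule integral_cong_AE[OF G])
    show "(\<lambda>\<omega>. \<Sum>t\<in>Str. g t * indicator {t} (\<sigma> (W 1 \<omega>))) \<in> borel_measurable M"
      by (intro borel_measurable_sum borel_measurable_times borel_measurable_const ind)
    show "AE \<omega> in M. G \<omega> = (\<Sum>t\<in>Str. g t * indicator {t} (\<sigma> (W 1 \<omega>)))"
      using AE_stratum_prob_nonzero AE_space
    proof eventually_elim
      case (elim \<omega>)
      then show ?case
        using sum_indicator_stratum[OF finite_Str stratum_in_Str[of 1 \<omega>], of g] eq[of \<omega>] by simp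
    qed
  qed
  also have "\<dots> = (\<Sum>t\<in>Str. g t * stratum_prob t)"
    unfolding stratum_prob_def using integrable_stratum_indicator
    by (subst Bochner_Integration.integral_sum) (simp_all only: integrable_mult_right integral_mult_right_zero)
  finally show ?thesis .
qed

text \<open>Both integrands are homogeneous of degree 1 in the conditional means, so weighting by
  the stratum probability replaces these means by stratum integrals. This brings the estimand into
  the form of the limit in \<open>sfe_coef_tendsto\<close>.\<close>

lemma theta_sfe_eq:
  defines "a \<equiv> stratum_integral r1" and "b \<equiv> stratum_integral r0"
    and "u \<equiv> stratum_integral (\<lambda>w. r1 w * y1 w)" and "v \<equiv> stratum_integral (\<lambda>w. r0 w * y0 w)"
  shows "theta_sfe M Str \<nu> (\<lambda>\<omega>. y1 (W 1 \<omega>)) (\<lambda>\<omega>. y0 (W 1 \<omega>)) (\<lambda>\<omega>. r1 (W 1 \<omega>)) (\<lambda>\<omega>. r0 (W 1 \<omega>)) (\<lambda>\<omega>. \<sigma> (W 1 \<omega>)) =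
    (\<Sum>t\<in>Str. (u t * b t - v t * a t) / (\<nu> * a t + (1 - \<nu>) * b t)) /
    (\<Sum>t\<in>Str. a t * b t / (\<nu> * a t + (1 - \<nu>) * b t))"
proof -
  let ?E = "cond_expect M (count_space Str) (\<lambda>\<omega>. \<sigma> (W 1 \<omega>))"
  have Em[measurable]: "?E f \<in> borel_measurable M" for f
  proof -
    interpret sigma_finite_subalgebra M "sigma_gen M (count_space Str) (\<lambda>\<omega>. \<sigma> (W 1 \<omega>))"
      by (rule sigma_finite_sigma_gen) (rule measurable_compose[OF measurable_W1(1) measurable_stratum])
    show ?thesis unfolding cond_expect_def by (rule borel_measurable_cond_exp2)
  qed
  define ma where "ma t = stratum_mean t r1" for t
  define mb where "mb t = stratum_mean t r0" for t
  define mu where "mu t = stratum_mean t (\<lambda>w. r1 w * y1 w)" for t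
  define mv where "mv t = stratum_mean t (\<lambda>w. r0 w * y0 w)" for t
  have means: "a t = ma t * stratum_prob t" "b t = mb t * stratum_prob t"
    "u t = mu t * stratum_prob t" "v t = mv t * stratum_prob t" for t
    unfolding a_def b_def u_def v_def ma_def mb_def mu_def mv_def
    using stratum_integral_eq[OF integrable_response(1)] stratum_integral_eq[OF integrable_response(2)]
      stratum_integral_eq[of "\<lambda>w. r1 w * y1 w", OF integrable_observed(1)]
      stratum_integral_eq[of "\<lambda>w. r0 w * y0 w", OF integrable_observed(2)]
    by blast+
  have E: "?E (\<lambda>\<omega>. r1 (W 1 \<omega>)) \<omega> = ma (\<sigma> (W 1 \<omega>))" "?E (\<lambda>\<omega>. r0 (W 1 \<omega>)) \<omega> = mb (\<sigma> (W 1 \<omega>))"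
    "?E (\<lambda>\<omega>. r1 (W 1 \<omega>) * y1 (W 1 \<omega>)) \<omega> = mu (\<sigma> (W 1 \<omega>))"
    "?E (\<lambda>\<omega>. r0 (W 1 \<omega>) * y0 (W 1 \<omega>)) \<omega> = mv (\<sigma> (W 1 \<omega>))"
    if "\<omega> \<in> space M" "stratum_prob (\<sigma> (W 1 \<omega>)) \<noteq> 0" for \<omega>
    using cond_expect_stratum[OF integrable_response(1) that] cond_expect_stratum[OF integrable_response(2) that]
      cond_expect_stratum[of "\<lambda>w. r1 w * y1 w", OF integrable_observed(1) that]
      cond_expect_stratum[of "\<lambda>w. r0 w * y0 w", OF integrable_observed(2) that]
    unfolding ma_def mb_def mu_def mv_def by blast+
  have I1: "(\<integral>\<omega>. ?E (\<lambda>\<omega>. r1 (W 1 \<omega>)) \<omega> * ?E (\<lambda>\<omega>. r0 (W 1 \<omega>)) \<omega> /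
      (\<nu> * ?E (\<lambda>\<omega>. r1 (W 1 \<omega>)) \<omega> + (1 - \<nu>) * ?E (\<lambda>\<omega>. r0 (W 1 \<omega>)) \<omega>) \<partial>M) =
    (\<Sum>t\<in>Str. (ma t * mb t / (\<nu> * ma t + (1 - \<nu>) * mb t)) * stratum_prob t)"
    by (rule integral_stratum_function, intro borel_measurable_divide borel_measurable_times
        borel_measurable_add borel_measurable_diff borel_measurable_const Em) (simp only: E not_False_eq_True)
  have I2: "(\<integral>\<omega>. (?E (\<lambda>\<omega>. r1 (W 1 \<omega>) * y1 (W 1 \<omega>)) \<omega> * ?E (\<lambda>\<omega>. r0 (W 1 \<omega>)) \<omega>
      - ?E (\<lambda>\<omega>. r0 (W 1 \<omega>) * y0 (W 1 \<omega>)) \<omega> * ?E (\<lambda>\<omega>. r1 (W 1 \<omega>)) \<omega>) /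
      (\<nu> * ?E (\<lambda>\<omega>. r1 (W 1 \<omega>)) \<omega> + (1 - \<nu>) * ?E (\<lambda>\<omega>. r0 (W 1 \<omega>)) \<omega>) \<partial>M) =
    (\<Sum>t\<in>Str. ((mu t * mb t - mv t * ma t) / (\<nu> * ma t + (1 - \<nu>) * mb t)) * stratum_prob t)"
    by (rule integral_stratum_function, intro borel_measurable_divide borel_measurable_times
        borel_measurable_add borel_measurable_diff borel_measurable_const Em) (simp only: E not_False_eq_True)
  \<comment> \<open>For \<open>p = 0\<close> both sides are 0, so null strata need no separate
    treatment.\<close>
  have scale: "c * p * p / (\<nu> * (z * p) + (1 - \<nu>) * (w * p)) = c / (\<nu> * z + (1 - \<nu>) * w) * p"
    for c z w p :: real
  proof (cases "p = 0")
    case False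
    have "\<nu> * (z * p) + (1 - \<nu>) * (w * p) = (\<nu> * z + (1 - \<nu>) * w) * p" by algebra
    then show ?thesis using False by simp
  qed simp
  have T1: "ma t * mb t / (\<nu> * ma t + (1 - \<nu>) * mb t) * stratum_prob t =
      a t * b t / (\<nu> * a t + (1 - \<nu>) * b t)" for t
    unfolding means scale[symmetric] by (simp add: mult_ac)
  have T2: "(mu t * mb t - mv t * ma t) / (\<nu> * ma t + (1 - \<nu>) * mb t) * stratum_prob t =
      (u t * b t - v t * a t) / (\<nu> * a t + (1 - \<nu>) * b t)" for t
    unfolding means scale[symmetric] by (intro arg_cong2[where f = "(/)"] refl) algebra
  show ?thesis
    unfolding theta_sfe_def Let_def I1 I2 T1 T2
    by (rule trans[OF mult.commute divide_inverse[symmetric]])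
qed

end

theorem theorem3p2:
  fixes M :: "'w measure"
    and NX :: "'x measure"
    and Y1 Y0 R1 R0 :: "nat \<Rightarrow> 'w \<Rightarrow> real"
    and X :: "nat \<Rightarrow> 'w \<Rightarrow> 'x"
    and W :: "nat \<Rightarrow> 'w \<Rightarrow> real \<times> real \<times> real \<times> real \<times> 'x"
    and NW :: "(real \<times> real \<times> real \<times> real \<times> 'x) measure"
    and Str :: "'s set"
    and S :: "'x \<Rightarrow> 's"
    and \<nu> :: real
    and D :: "nat \<Rightarrow> nat \<Rightarrow> 'w \<Rightarrow> real"
  assumes M: "prob_space M"
    and W: "W = (\<lambda>i \<omega>. (Y1 i \<omega>, Y0 i \<omega>, R1 i \<omega>, R0 i \<omega>, X i \<omega>))"
    and NW: "NW = borel \<Otimes>\<^sub>M borel \<Otimes>\<^sub>M borel \<Otimes>\<^sub>M borel \<Otimes>\<^sub>M NX"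
    and indep: "prob_space.indep_vars M (\<lambda>_. NW) W {1..}"
    and ident: "\<And>i. i \<ge> 1 \<Longrightarrow> distr M NW (W i) = distr M NW (W 1)"
    and R1_bin: "\<And>i \<omega>. i \<ge> 1 \<Longrightarrow> \<omega> \<in> space M \<Longrightarrow> R1 i \<omega> \<in> {0, 1}"
    and R0_bin: "\<And>i \<omega>. i \<ge> 1 \<Longrightarrow> \<omega> \<in> space M \<Longrightarrow> R0 i \<omega> \<in> {0, 1}"
    and Y1_int: "\<And>i. i \<ge> 1 \<Longrightarrow> integrable M (Y1 i)"
    and Y0_int: "\<And>i. i \<ge> 1 \<Longrightarrow> integrable M (Y0 i)"
    and R1_pos: "\<And>i. i \<ge> 1 \<Longrightarrow> (\<integral>\<omega>. R1 i \<omega> \<partial>M) > 0"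
    and R0_pos: "\<And>i. i \<ge> 1 \<Longrightarrow> (\<integral>\<omega>. R0 i \<omega> \<partial>M) > 0"
    and Str: "finite Str"
    and S: "S \<in> measurable NX (count_space Str)"
    and nu: "0 < \<nu>" "\<nu> < 1"
    and D_bin: "\<And>n i \<omega>. i \<in> {1..n} \<Longrightarrow> \<omega> \<in> space M \<Longrightarrow> D n i \<omega> \<in> {0, 1}"
    and cond_indep: "\<And>n. cond_indep_var M
          (Pi\<^sub>M {1..n} (\<lambda>_. NW)) (\<lambda>\<omega>. \<lambda>i\<in>{1..n}. W i \<omega>)
          (Pi\<^sub>M {1..n} (\<lambda>_. borel)) (\<lambda>\<omega>. \<lambda>i\<in>{1..n}. D n i \<omega>)
          (Pi\<^sub>M {1..n} (\<lambda>_. count_space Str)) (\<lambda>\<omega>. \<lambda>i\<in>{1..n}. S (X i \<omega>))"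
    and balance: "\<And>s. s \<in> Str \<Longrightarrow> tendsto_in_prob M
          (\<lambda>n \<omega>. (1 / real n) * (\<Sum>i=1..n. (D n i \<omega> - \<nu>) * indicator {s} (S (X i \<omega>)))) 0"
  shows "tendsto_in_prob M
          (\<lambda>n \<omega>. diff_in_means n
             (\<lambda>i. observed_outcome Y1 Y0 R1 R0 (D n) i \<omega>)
             (\<lambda>i. realized_response R1 R0 (D n) i \<omega>)
             (\<lambda>i. D n i \<omega>))
          (theta_obs M (Y1 1) (Y0 1) (R1 1) (R0 1)) \<and>
        theta_obs M (Y1 1) (Y0 1) (R1 1) (R0 1) =
          cond_expect_event M (Y1 1) {\<omega> \<in> space M. R1 1 \<omega> = 1} -
          cond_expect_event M (Y0 1) {\<omega> \<in> space M. R0 1 \<omega> = 1} \<and>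
        tendsto_in_prob M
          (\<lambda>n \<omega>. sfe_coef Str n
             (\<lambda>i. observed_outcome Y1 Y0 R1 R0 (D n) i \<omega>)
             (\<lambda>i. realized_response R1 R0 (D n) i \<omega>)
             (\<lambda>i. D n i \<omega>)
             (\<lambda>i. S (X i \<omega>)))
          (theta_sfe M Str \<nu> (Y1 1) (Y0 1) (R1 1) (R0 1) (\<lambda>\<omega>. S (X 1 \<omega>)))"
proof -
  interpret prob_space M by (rule M)
  \<comment> \<open>The coordinates of the tuple serve as the functions of the unit datum that the
    locale expects; through \<open>W_sel\<close> its results turn into the statement.\<close>
  let ?\<sigma> = "\<lambda>w :: real \<times> real \<times> real \<times> real \<times> 'x. S (snd (snd (snd (snd w))))"
  let ?y1 = "\<lambda>w :: real \<times> real \<times> real \<times> real \<times> 'x. fst w"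
  let ?y0 = "\<lambda>w :: real \<times> real \<times> real \<times> real \<times> 'x. fst (snd w)"
  let ?r1 = "\<lambda>w :: real \<times> real \<times> real \<times> real \<times> 'x. fst (snd (snd w))"
  let ?r0 = "\<lambda>w :: real \<times> real \<times> real \<times> real \<times> 'x. fst (snd (snd (snd w)))"
  note [measurable] = S
  have W_sel: "?y1 (W i \<omega>) = Y1 i \<omega>" "?y0 (W i \<omega>) = Y0 i \<omega>" "?r1 (W i \<omega>) = R1 i \<omega>" "?r0 (W i \<omega>) = R0 i \<omega>"
    "?\<sigma> (W i \<omega>) = S (X i \<omega>)" for i \<omega>
    by (simp_all add: W)
  interpret attrition_experiment M NW W Str ?\<sigma> D \<nu> ?y1 ?y0 ?r1 ?r0
  proof unfold_locales
    show "?\<sigma> \<in> measurable NW (count_space Str)"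
      "?y1 \<in> borel_measurable NW" "?y0 \<in> borel_measurable NW"
      "?r1 \<in> borel_measurable NW" "?r0 \<in> borel_measurable NW"
      unfolding NW by measurable
    show "distr M NW (W i) = distr M NW (W 1)" if "i \<ge> 1" for i
      by (rule ident[OF that])
    show "D n i \<omega> \<in> {0, 1}" if "i \<in> {1..n}" "\<omega> \<in> space M" for n i \<omega>
      by (rule D_bin[OF that])
  qed (simp_all only: W_sel indep Str nu cond_indep balance R1_bin R0_bin Y1_int Y0_int R1_pos R0_pos le_refl)
  have R_meas: "R1 1 \<in> borel_measurable M" "R0 1 \<in> borel_measurable M"
    using integrable_response unfolding W_sel by auto
  have "theta_obs M (Y1 1) (Y0 1) (R1 1) (R0 1) =
      cond_expect_event M (Y1 1) {\<omega> \<in> space M. R1 1 \<omega> = 1} -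
      cond_expect_event M (Y0 1) {\<omega> \<in> space M. R0 1 \<omega> = 1}"
    unfolding theta_obs_def
    using cond_expect_event_binary[OF R_meas(1) R1_bin R1_pos Y1_int]
      cond_expect_event_binary[OF R_meas(2) R0_bin R0_pos Y0_int] by simp
  moreover have "tendsto_in_prob M
      (\<lambda>n \<omega>. sfe_coef Str n
         (\<lambda>i. observed_outcome Y1 Y0 R1 R0 (D n) i \<omega>)
         (\<lambda>i. realized_response R1 R0 (D n) i \<omega>)
         (\<lambda>i. D n i \<omega>)
         (\<lambda>i. S (X i \<omega>)))
      (theta_sfe M Str \<nu> (Y1 1) (Y0 1) (R1 1) (R0 1) (\<lambda>\<omega>. S (X 1 \<omega>)))"
    using sfe_coef_tendsto unfolding theta_sfe_eq[symmetric] unfolding W_sel .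
  ultimately show ?thesis
    using diff_in_means_tendsto unfolding W_sel by blast
qed

end
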